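(* Let $p,q$ be primes with $p\ge 3$ and $p\mid q-1$, let $s$ be an integer with $\operatorname{ord}_q(s)=p$ (i.e. $p$ is the least positive integer with $s^p\equiv 1 \pmod q$), and let $G_{pq}=\langle x,y : x^p=y^q=1,\ yx=xy^s\rangle$ be the corresponding nonabelian group of order $pq$. Then for every positive integer $k$, $$\mathsf{s}_{kp\mathbb{N}}(G_{pq})=\operatorname{lcm}(kp,q)+p-2+\gcd(kp,q).$$
   Context: A sequence over a finite group $G$ is a finite unordered list of elements of $G$ with repetition allowed; its length is the number of terms counted with multiplicity, and a subsequence is a sub-multiset. A sequence $g_1,\dots,g_\ell$ is a $1$-product sequence if $g_{\tau(1)}\cdots g_{\tau(\ell)}=1$ for some permutation $\tau$ of $\{1,\dots,\ell\}$. For a positive integer $d$, $\mathsf{s}_{d\mathbb{N}}(G)$ denotes the smallest $\ell\in\mathbb{N}_0\cup\{+\infty\}$ such that every sequence over $G$ of length at least $\ell$ has a nonempty $1$-product subsequence $T$ with $|T|\equiv 0\pmod d$. *)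

theory Defs
  imports "HOL-Algebra.Group" "HOL-Number_Theory.Cong" "HOL-Library.Multiset"
    "HOL-Library.Extended_Nat"
begin

section \<open>Groups given by generators and relations\<close>

text \<open>
  A word is a list of letters; the letter \<open>(g, False)\<close> stands for the generator \<open>g\<close> and
  \<open>(g, True)\<close> for its formal inverse.  A relation \<open>u = v\<close> is the pair \<open>(u, v)\<close> of words.
\<close>

type_synonym 'g word = "('g \<times> bool) list"

definition word_pow :: "'g \<Rightarrow> int \<Rightarrow> 'g word" where
  "word_pow g n = replicate (nat \<bar>n\<bar>) (g, n < 0)"

inductive pres_eq :: "('g word \<times> 'g word) set \<Rightarrow> 'g word \<Rightarrow> 'g word \<Rightarrow> bool"
  for R :: "('g word \<times> 'g word) set"
where
  rel: "(u, v) \<in> R \<Longrightarrow> pres_eq R u v"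
| cancel: "pres_eq R [(g, b), (g, \<not> b)] []"
| refl: "pres_eq R u u"
| sym: "pres_eq R u v \<Longrightarrow> pres_eq R v u"
| trans: "pres_eq R u v \<Longrightarrow> pres_eq R v w \<Longrightarrow> pres_eq R u w"
| append: "pres_eq R u v \<Longrightarrow> pres_eq R u' v' \<Longrightarrow> pres_eq R (u @ u') (v @ v')"

definition pres_class :: "('g word \<times> 'g word) set \<Rightarrow> 'g word \<Rightarrow> 'g word set" where
  "pres_class R u = {v. pres_eq R u v}"

text \<open>The group with generators all elements of the type \<open>'g\<close> and relations \<open>R\<close>.\<close>

definition presented_group :: "('g word \<times> 'g word) set \<Rightarrow> 'g word set monoid" where
  "presented_group R =
    \<lparr>carrier = range (pres_class R),
     monoid.mult = (\<lambda>A B. \<Union>u\<in>A. \<Union>v\<in>B. pres_class R (u @ v)),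
     monoid.one = pres_class R []\<rparr>"

datatype gen = gen_x | gen_y

definition Gpq :: "nat \<Rightarrow> nat \<Rightarrow> int \<Rightarrow> gen word set monoid" where
  "Gpq p q s = presented_group
    {(word_pow gen_x (int p), []),
     (word_pow gen_y (int q), []),
     (word_pow gen_y 1 @ word_pow gen_x 1, word_pow gen_x 1 @ word_pow gen_y s)}"


section \<open>Product-one sequences\<close>

text \<open>
  Sequences over \<open>G\<close> are finite multisets of elements of the carrier; the lists \<open>gs\<close> with
  \<open>mset gs = S\<close> are the orderings of the terms of \<open>S\<close>.
\<close>

definition one_product_seq :: "('a, 'b) monoid_scheme \<Rightarrow> 'a multiset \<Rightarrow> bool" where
  "one_product_seq G S \<longleftrightarrow> (\<exists>gs. mset gs = S \<and> foldr (\<otimes>\<^bsub>G\<^esub>) gs \<one>\<^bsub>G\<^esub> = \<one>\<^bsub>G\<^esub>)"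

text \<open>The infimum in \<^typ>\<open>enat\<close> is the minimum of a nonempty set, and \<open>\<infinity>\<close> for the empty set.\<close>

definition s_dN :: "nat \<Rightarrow> ('a, 'b) monoid_scheme \<Rightarrow> enat" where
  "s_dN d G = Inf {enat l | l.
     \<forall>S. set_mset S \<subseteq> carrier G \<and> size S \<ge> l \<longrightarrow>
       (\<exists>T. T \<subseteq># S \<and> T \<noteq> {#} \<and> d dvd size T \<and> one_product_seq G T)}"

end

theory Submission
  imports Defs "HOL-Library.Set_Algebras" "HOL-Computational_Algebra.Primes"
begin

text \<open>
  Writing the elements as \<open>x\<^sup>a y\<^sup>b\<close>, a product of terms lies in \<open>N = \<langle>y\<rangle>\<close> iff \<open>p\<close> divides the sum of
  the exponents \<open>a\<close>, and its \<open>y\<close>-exponent is then a sum of the \<open>b\<close> twisted by powers of \<open>s\<close>.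

  If \<open>q\<close> does not divide \<open>k\<close>, the Erdos-Ginzburg-Ziv theorem yields \<open>q\<close> disjoint blocks of length
  \<open>k p\<close> with product in \<open>N\<close>, and some of these \<open>q\<close> products multiply to \<open>1\<close>.

  If \<open>q\<close> divides \<open>k\<close>, it suffices to find a product-one subsequence of length \<open>p q\<close> in a sequence of
  length \<open>p q + p + q - 2\<close>.  By Cauchy-Davenport, \<open>q - 1\<close> independent choices between two values
  reach all of \<open>N\<close>.  Such choices come from non-commuting pairs (two orders), from pairs of distinct
  elements in one coset of \<open>N\<close> (take either of them), or from moving a term past copies of a term
  not commuting with it.  If the \<open>a\<close> are spread out, non-commuting pairs suffice.  Otherwise almost
  all terms lie in one coset of \<open>N\<close>, and either there are enough pairs of distinct elements in it or
  one element \<open>g\<close> dominates.  For \<open>g \<noteq> 1\<close> the terms not commuting with \<open>g\<close> are moved past copies of \<open>g\<close>.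
  For \<open>g = 1\<close> it is enough that every sequence of length \<open>p + q - 1\<close> has a nonempty product-one
  subsequence; this holds because the rotations of a minimal block with product in \<open>N - {1}\<close> give as
  many products as the block has terms.
\<close>

section \<open>The Cauchy-Davenport theorem and twisted sums\<close>

definition sumset_mod :: "nat \<Rightarrow> int set \<Rightarrow> int set \<Rightarrow> int set" where
  "sumset_mod n A B = (\<lambda>(a, b). (a + b) mod int n) ` (A \<times> B)"

text \<open>As \<open>n\<close> is prime, \<open>d\<close> is invertible modulo \<open>n\<close>, so
  repeated shifts of one element run through all residues.\<close>

lemma closed_under_shift_full:
  fixes A :: "int set"
  assumes n: "prime n" and A: "A \<subseteq> {0..<int n}" "A \<noteq> {}" and d: "\<not> int n dvd d"
    and closed: "\<And>a. a \<in> A \<Longrightarrow> (a + d) mod int n \<in> A"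
  shows "A = {0..<int n}"
proof -
  obtain a where a: "a \<in> A" using A by blast
  have step: "(a + int i * d) mod int n \<in> A" for i
  proof (induction i)
    case 0
    then show ?case using a A by (auto simp: subset_iff)
  next
    case (Suc i)
    have "((a + int i * d) mod int n + d) mod int n = (a + int (Suc i) * d) mod int n"
      unfolding mod_add_left_eq by (simp add: algebra_simps)
    then show ?case using closed[OF Suc] by simp
  qed
  have npos: "int n > 0" using n prime_gt_0_nat by simp
  have cop: "coprime d (int n)"
    using n d by (metis coprime_commute prime_imp_coprime prime_int_nat_transfer prime_nat_int_transfer)
  have "x \<in> A" if x: "x \<in> {0..<int n}" for x
  proof -
    obtain u where u: "[d * u = 1] (mod int n)"
      using cop cong_solve_coprime_int by blast
    define i where "i = nat ((u * (x - a)) mod int n)"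
    have "[int i * d = (u * (x - a)) * d] (mod int n)"
      using npos unfolding i_def cong_def by (simp add: mod_mult_left_eq)
    also have "(u * (x - a)) * d = (d * u) * (x - a)" by (simp add: algebra_simps)
    also have "[(d * u) * (x - a) = 1 * (x - a)] (mod int n)" by (intro cong_mult u cong_refl)
    finally have "[a + int i * d = a + (x - a)] (mod int n)" by (intro cong_add) auto
    then have "(a + int i * d) mod int n = x" using x by (simp add: cong_def)
    then show ?thesis using step[of i] by simp
  qed
  then show ?thesis using A by blast
qed

text \<open>Induction on \<open>card B\<close>: unless \<open>A\<close> is everything or
  \<open>B\<close> a singleton, a transform keeps \<open>card A + card B\<close>, shrinks
  \<open>B\<close> and does not enlarge the sumset.\<close>

theorem Cauchy_Davenport_mod:
  fixes A B :: "int set"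
  assumes n: "prime n" and "A \<subseteq> {0..<int n}" "A \<noteq> {}" "B \<subseteq> {0..<int n}" "B \<noteq> {}"
  shows "card (sumset_mod n A B) \<ge> min n (card A + card B - 1)"
  using assms(2-)
proof (induction "card B" arbitrary: A B rule: less_induct)
  case less
  have npos: "int n > 0" using n prime_gt_0_nat by simp
  have finA: "finite A" and finB: "finite B" using less.prems finite_subset by blast+
  have finS: "finite (sumset_mod n A B)" unfolding sumset_mod_def using finA finB by simp
  have shift_inj: "inj_on (\<lambda>x. (x + e) mod int n) X" if "X \<subseteq> {0..<int n}" for X e
  proof (rule inj_onI)
    fix x y assume xy: "x \<in> X" "y \<in> X" "(x + e) mod int n = (y + e) mod int n"
    then have "[x = y] (mod int n)" unfolding cong_def[symmetric] by (simp add: cong_add_rcancel)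
    then show "x = y" using xy that by (auto simp: cong_def subset_iff)
  qed
  obtain b0 where b0: "b0 \<in> B" using less.prems by blast
  have A_le: "card A \<le> card (sumset_mod n A B)"
  proof -
    have "card A = card ((\<lambda>x. (x + b0) mod int n) ` A)"
      by (rule card_image[symmetric, OF shift_inj[OF less.prems(1)]])
    also have "\<dots> \<le> card (sumset_mod n A B)"
      using b0 by (intro card_mono finS) (auto simp: sumset_mod_def)
    finally show ?thesis .
  qed
  show ?case
  proof (cases "A = {0..<int n} \<or> B = {b0}")
    case True
    then show ?thesis using A_le by auto
  next
    case False
    then obtain b1 where b1: "b1 \<in> B" "b1 \<noteq> b0" using b0 by blast
    have nd: "\<not> int n dvd (b1 - b0)"
    proof
      assume "int n dvd (b1 - b0)"
      then have "[b1 = b0] (mod int n)" by (simp add: cong_iff_dvd_diff)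
      then show False using b1 b0 less.prems by (auto simp: cong_def subset_iff)
    qed
    \<comment> \<open>\<open>A\<close> is not the set of all residues, so the shift by
      \<open>b1 - b0\<close> leaves it at some \<open>a\<close>; this \<open>a\<close> keeps
      \<open>b0\<close> in \<open>B'\<close> and \<open>b1\<close> out of it.\<close>
    obtain a where a: "a \<in> A" "(a + (b1 - b0)) mod int n \<notin> A"
      using closed_under_shift_full[OF n less.prems(1,2) nd] False by blast
    \<comment> \<open>Dyson's \<open>e\<close>-transform moves elements from \<open>B\<close> to \<open>A\<close>.\<close>
    define e where "e = a - b0"
    define sh where "sh = (\<lambda>b. (b + e) mod int n)"
    define B' where "B' = {b \<in> B. sh b \<in> A}"
    define A' where "A' = A \<union> sh ` B"
    have "sh b0 = a" using a less.prems by (auto simp: sh_def e_def subset_iff)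
    then have "b0 \<in> B'" using a b0 by (simp add: B'_def)
    moreover have "b1 \<notin> B'" using a(2) by (simp add: B'_def sh_def e_def algebra_simps)
    ultimately have B': "B' \<noteq> {}" "B' \<subset> B" using b1 by (auto simp: B'_def)
    have A': "A' \<subseteq> {0..<int n}" "A' \<noteq> {}" using less.prems npos by (auto simp: A'_def sh_def)
    have "A' = A \<union> sh ` (B - B')" unfolding A'_def B'_def by auto
    moreover have "A \<inter> sh ` (B - B') = {}" unfolding B'_def by auto
    moreover have "card (sh ` (B - B')) = card (B - B')"
      unfolding sh_def by (rule card_image, rule shift_inj) (use less.prems in auto)
    ultimately have "card A' = card A + card (B - B')"
      using finA finB by (simp add: card_Un_disjoint)
    then have cards: "card A' + card B' = card A + card B"
      using B'(2) finB by (metis add.assoc add.commute card_Diff_subset card_mono finite_subset le_add_diff_inverse2 psubset_imp_subset)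
    have "sumset_mod n A' B' \<subseteq> sumset_mod n A B"
    proof
      fix z assume "z \<in> sumset_mod n A' B'"
      then obtain x y where xy: "x \<in> A'" "y \<in> B'" "z = (x + y) mod int n"
        by (auto simp: sumset_mod_def)
      show "z \<in> sumset_mod n A B"
      proof (cases "x \<in> A")
        case True
        then show ?thesis using xy B'(2) by (auto simp: sumset_mod_def)
      next
        case False
        then obtain b where b: "b \<in> B" "x = sh b" using xy by (auto simp: A'_def)
        \<comment> \<open>The shift changes places: \<open>sh b + y\<close> equals
          \<open>sh y + b\<close> modulo \<open>n\<close>, and \<open>sh y\<close> lies in
          \<open>A\<close> because \<open>y\<close> is in \<open>B'\<close>.\<close>
        have "z = (sh y + b) mod int n" 
          unfolding xy(3) b(2) sh_def mod_add_left_eq by (simp add: algebra_simps)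
        then show ?thesis using xy(2) b by (auto simp: sumset_mod_def B'_def)
      qed
    qed
    then have "card (sumset_mod n A' B') \<le> card (sumset_mod n A B)" by (rule card_mono[OF finS])
    moreover have "min n (card A' + card B' - 1) \<le> card (sumset_mod n A' B')"
      using less.hyps[OF psubset_card_mono[OF finB B'(2)] A'] B' less.prems(3) by blast
    ultimately show ?thesis using cards by simp
  qed
qed

text \<open>
  For \<open>n = q\<close> and \<open>m = p\<close>, a term \<open>t\<close> stands for \<open>x\<^sup>a y\<^sup>b\<close> with \<open>a = wa t\<close> and \<open>b = wb t\<close>, and \<open>tw\<close> of a
  list is the exponent of \<open>y\<close> in its ordered product, since \<open>y\<^sup>b x\<^sup>a = x\<^sup>a y\<^bsup>b s^a\<^esup>\<close>.
  The case \<open>m = 1\<close>, \<open>s = 1\<close> gives ordinary sums modulo a prime.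
\<close>

locale twisted =
  fixes n m :: nat and s :: int and wa :: "'a \<Rightarrow> nat" and wb :: "'a \<Rightarrow> int"
  assumes prime_n: "prime n" and s_pow: "[s ^ m = 1] (mod int n)" and m_pos: "m > 0"
begin

section \<open>Exponents reachable by reordering and choosing terms\<close>

definition asum :: "'a multiset \<Rightarrow> nat" where "asum M = (\<Sum>x\<in>#M. wa x)"

primrec tw :: "'a list \<Rightarrow> int" where
  "tw [] = 0"
| "tw (x # xs) = s ^ asum (mset xs) * wb x + tw xs"

text \<open>For a single multiset these are the exponents of \<open>y\<close> that its orderings
  reach; several multisets add a choice of terms.\<close>

definition tws :: "'a multiset set \<Rightarrow> int set" where
  "tws \<M> = (\<lambda>xs. tw xs mod int n) ` {xs. mset xs \<in> \<M>}"

lemma asum_simps [simp]: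
  "asum {#} = 0" "asum (add_mset x M) = wa x + asum M" "asum (M + N) = asum M + asum N"
  by (auto simp: asum_def)

lemma n_pos: "int n > 0"
  using prime_n prime_gt_0_nat by simp

lemma tw_append: "tw (xs @ ys) = s ^ asum (mset ys) * tw xs + tw ys"
  by (induction xs) (auto simp: algebra_simps power_add)

lemma coprime_s: "coprime s (int n)"
proof -
  have "coprime (s ^ m) (int n)" using s_pow by (metis cong_imp_coprime cong_sym coprime_1_left)
  then show ?thesis using m_pos by simp
qed

lemma s_pow_cong:
  assumes "[a = b] (mod m)" shows "[s ^ a = s ^ b] (mod int n)"
proof -
  have red: "[s ^ c = s ^ (c mod m)] (mod int n)" for c
  proof -
    have "s ^ c = (s ^ m) ^ (c div m) * s ^ (c mod m)"
      by (metis div_mult_mod_eq mult.commute power_add power_mult)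
    also have "[\<dots> = 1 ^ (c div m) * s ^ (c mod m)] (mod int n)"
      by (intro cong_mult cong_pow s_pow cong_refl)
    finally show ?thesis by simp
  qed
  show ?thesis using red[of a] red[of b] assms by (metis cong_def)
qed

lemma tws_subset: "tws \<M> \<subseteq> {0..<int n}"
  using n_pos by (auto simp: tws_def)

lemma finite_tws [simp]: "finite (tws \<M>)"
  using tws_subset finite_subset by blast

lemma tws_nonempty: "\<M> \<noteq> {} \<Longrightarrow> tws \<M> \<noteq> {}"
  unfolding tws_def using ex_mset by (metis (mono_tags, lifting) empty_is_image equals0I mem_Collect_eq empty_iff)

lemma tws_mono: "\<M> \<subseteq> \<N> \<Longrightarrow> tws \<M> \<subseteq> tws \<N>"
  by (auto simp: tws_def)

lemma card_tws_pos: "\<M> \<noteq> {} \<Longrightarrow> card (tws \<M>) \<ge> 1"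
  using tws_nonempty by (simp add: Suc_leI card_gt_0_iff)

text \<open>Concatenation scales the first exponent by \<open>s ^ c\<close>, since all members of
  \<open>\<N>\<close> have weight \<open>c\<close> modulo \<open>m\<close>. Scaling by a unit keeps
  the cardinality, and Cauchy-Davenport applies.\<close>

lemma card_tws_plus:
  assumes "\<M> \<noteq> {}" "\<N> \<noteq> {}" and c: "\<And>N. N \<in> \<N> \<Longrightarrow> [asum N = c] (mod m)"
  shows "card (tws (\<M> + \<N>)) \<ge> min n (card (tws \<M>) + card (tws \<N>) - 1)"
proof -
  define sc where "sc = (\<lambda>x. (s ^ c * x) mod int n)"
  have cop: "coprime (s ^ c) (int n)" using coprime_s by simp
  have "inj_on sc (tws \<M>)"
  proof (rule inj_onI)
    fix x y assume xy: "x \<in> tws \<M>" "y \<in> tws \<M>" "sc x = sc y"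
    then have "[x = y] (mod int n)"
      using cong_mult_lcancel[OF cop] by (simp add: sc_def cong_def)
    then show "x = y" using xy tws_subset by (fastforce simp: cong_def subset_iff)
  qed
  then have card_sc: "card (sc ` tws \<M>) = card (tws \<M>)" by (rule card_image)
  have "sumset_mod n (sc ` tws \<M>) (tws \<N>) \<subseteq> tws (\<M> + \<N>)"
  proof
    fix z assume "z \<in> sumset_mod n (sc ` tws \<M>) (tws \<N>)"
    then obtain xs ys where xy: "mset xs \<in> \<M>" "mset ys \<in> \<N>"
      "z = (sc (tw xs mod int n) + tw ys mod int n) mod int n"
      by (auto simp: sumset_mod_def tws_def)
    have "[s ^ c * tw xs = s ^ asum (mset ys) * tw xs] (mod int n)"
      by (intro cong_mult cong_refl s_pow_cong cong_sym[OF c[OF xy(2)]])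
    then have "z = tw (xs @ ys) mod int n"
      using xy(3) unfolding sc_def tw_append cong_def mod_add_eq mod_mult_right_eq
      by (metis mod_add_left_eq)
    moreover have "mset (xs @ ys) \<in> \<M> + \<N>" using xy by auto
    ultimately show "z \<in> tws (\<M> + \<N>)" unfolding tws_def by blast
  qed
  then have "card (sumset_mod n (sc ` tws \<M>) (tws \<N>)) \<le> card (tws (\<M> + \<N>))"
    by (intro card_mono) auto
  moreover have "min n (card (sc ` tws \<M>) + card (tws \<N>) - 1)
      \<le> card (sumset_mod n (sc ` tws \<M>) (tws \<N>))"
    using n_pos assms tws_nonempty tws_subset
    by (intro Cauchy_Davenport_mod prime_n) (auto simp: sc_def)
  ultimately show ?thesis using card_sc by simp
qed

lemma tws_full:
  assumes "card (tws \<M>) \<ge> n"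
  obtains xs where "mset xs \<in> \<M>" "[tw xs = c] (mod int n)"
proof -
  have "tws \<M> = {0..<int n}" 
    using card_mono[OF _ tws_subset[of \<M>]] assms by (intro card_subset_eq tws_subset) auto
  then have "c mod int n \<in> tws \<M>" using n_pos by simp
  then show ?thesis using that by (auto simp: tws_def cong_def)
qed

end

section \<open>Zero-sum subsequences and selections from pairs\<close>

definition pairs_mset :: "('a \<times> 'a) list \<Rightarrow> 'a multiset" where
  "pairs_mset ps = mset (map fst ps) + mset (map snd ps)"

lemma pairs_mset_simps [simp]:
  "pairs_mset [] = {#}" "pairs_mset ((x, y) # ps) = {#x, y#} + pairs_mset ps"
  by (auto simp: pairs_mset_def)

lemma size_pairs_mset [simp]: "size (pairs_mset ps) = 2 * length ps"
  by (simp add: pairs_mset_def)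

lemma submultiset_of_size:
  assumes "k \<le> size M" obtains N where "N \<subseteq># M" "size N = k"
proof -
  obtain xs where xs: "mset xs = M" using ex_mset by blast
  have "mset (take k xs) \<subseteq># M"
    using xs by (metis append_take_drop_id mset_append mset_subset_eq_add_left)
  moreover have "size (mset (take k xs)) = k" using assms xs by auto
  ultimately show ?thesis using that by blast
qed

lemma submultiset_between:
  assumes "A \<subseteq># M" "size A \<le> k" "k \<le> size M"
  obtains N where "A \<subseteq># N" "N \<subseteq># M" "size N = k"
proof -
  have "k - size A \<le> size (M - A)" using assms by (simp add: size_Diff_submset)
  then obtain R where R: "R \<subseteq># M - A" "size R = k - size A" by (rule submultiset_of_size)
  have "A + R \<subseteq># M" using R(1) assms(1) by (metis subset_mset.add_diff_inverse subset_mset.add_left_mono)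
  then show ?thesis using that[of "A + R"] R(2) assms(2) by simp
qed

lemma size_filter_compl:
  "size (filter_mset P M) + size (filter_mset (\<lambda>x. \<not> P x) M) = size M"
  by (metis multiset_partition size_union)

text \<open>Greedy choice: pair an element of the most frequent key with any element of another key,
  and check that the hypotheses survive for the rest.\<close>

lemma disjoint_pairs_distinct_key:
  fixes key :: "'a \<Rightarrow> 'b"
  assumes "2 * m \<le> size Z" "\<And>v. m \<le> size {#z \<in># Z. key z \<noteq> v#}"
  shows "\<exists>ps. length ps = m \<and> (\<forall>(x, y) \<in> set ps. key x \<noteq> key y) \<and> pairs_mset ps \<subseteq># Z"
  using assms
proof (induction m arbitrary: Z)
  case 0
  then show ?case by (intro exI[of _ "[]"]) auto
next
  case (Suc m)
  define c where "c = (\<lambda>v. size {#z \<in># Z. key z = v#})"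
  define d where "d = (\<lambda>v. size {#z \<in># Z. key z \<noteq> v#})"
  have cd: "c v + d v = size Z" for v unfolding c_def d_def by (rule size_filter_compl)
  have "Z \<noteq> {#}" using Suc.prems by auto
  then have fin: "finite ((c \<circ> key) ` set_mset Z)" "(c \<circ> key) ` set_mset Z \<noteq> {}" by auto
  then obtain x where x: "x \<in># Z" "c (key x) = Max ((c \<circ> key) ` set_mset Z)"
    using Max_in[OF fin] by (metis (mono_tags, lifting) comp_apply imageE)
  have cmax: "c v \<le> c (key x)" for v
  proof (cases "\<exists>z. z \<in># Z \<and> key z = v")
    case True
    then show ?thesis using x fin by (auto intro: Max_ge)
  next
    case False
    then have "{#z \<in># Z. key z = v#} = {#}" by (auto simp: filter_mset_eq_mempty_iff)
    then have "c v = 0" unfolding c_def by (simp only: size_empty)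
    then show ?thesis by simp
  qed
  have "size {#z \<in># Z. key z \<noteq> key x#} \<noteq> 0" using Suc.prems(2)[of "key x"] by linarith
  then obtain y where y: "y \<in># Z" "key y \<noteq> key x" by (auto simp: filter_mset_eq_mempty_iff)
  define Z' where "Z' = Z - {#x, y#}"
  have sub: "{#x, y#} \<subseteq># Z" using x y by (auto simp: insert_subset_eq_iff in_diff_count)
  then have Z: "Z = {#x, y#} + Z'" unfolding Z'_def by (metis subset_mset.add_diff_inverse)
  have "m \<le> size {#z \<in># Z'. key z \<noteq> v#}" for v
  proof -
    have split: "d v = (if key x \<noteq> v then 1 else 0) + (if key y \<noteq> v then 1 else 0)
        + size {#z \<in># Z'. key z \<noteq> v#}"
      unfolding d_def by (subst Z) simp
    have dv: "d v \<ge> Suc m" unfolding d_def by (rule Suc.prems)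
    show ?thesis
    proof (cases "v = key x \<or> v = key y")
      case True
      then show ?thesis using split dv y(2) by auto
    next
      case False
      \<comment> \<open>Both removed elements lie outside the class of \<open>v\<close>, so
        \<open>d v\<close> has to be at least \<open>m + 2\<close>. It is, since \<open>d v\<close>
        exceeds \<open>c v\<close> and the two add up to at least \<open>2 * m + 2\<close>.\<close>
      have "{#z \<in># Z. key z = key x#} + {#z \<in># Z. key z = key y#} = {#z \<in># Z. key z = key x \<or> key z = key y#}"
        using y(2) by (intro multiset_eqI) auto
      also have "\<dots> \<subseteq># {#z \<in># Z. key z \<noteq> v#}"
        using False by (auto intro!: multiset_filter_mono simp: subseteq_mset_def)
      finally have "c (key x) + c (key y) \<le> d v" unfolding c_def d_def by (metis size_mset_mono size_union)
      moreover have "c (key y) \<ge> 1"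
        using y(1) unfolding c_def by (metis (mono_tags, lifting) One_nat_def Suc_leI filter_mset_eq_mempty_iff nonempty_has_size)
      moreover have "d v = 2 + size {#z \<in># Z'. key z \<noteq> v#}" using split False by auto
      moreover have "m \<le> r" if "a + b \<le> t" "1 \<le> b" "t = 2 + r" "u \<le> a" "u + t = l" "2 * Suc m \<le> l"
        for a b t r u l :: nat using that by arith
      ultimately show ?thesis using cmax[of v] cd[of v] Suc.prems(1) by blast
    qed
  qed
  moreover have "2 * m \<le> size Z'" using Suc.prems(1) Z by simp
  ultimately obtain ps where ps: "length ps = m" "\<forall>(x, y) \<in> set ps. key x \<noteq> key y" "pairs_mset ps \<subseteq># Z'"
    using Suc.IH by blast
  then show ?case using y(2) Z by (intro exI[of _ "(x, y) # ps"]) auto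
qed

section \<open>Zero-sum submultisets by the pigeonhole principle\<close>

text \<open>Among the \<open>n + 1\<close> sums of the prefixes of length \<open>0\<close> to
  \<open>n\<close>, two agree modulo \<open>n\<close>; the segment between them has sum
  zero.\<close>

lemma zero_sum_submultiset:
  fixes f :: "'a \<Rightarrow> int"
  assumes n: "n > 0" and U: "size U \<ge> n"
  shows "\<exists>V. V \<subseteq># U \<and> V \<noteq> {#} \<and> size V \<le> n \<and> int n dvd (\<Sum>x\<in>#V. f x)"
proof -
  obtain xs where xs: "mset xs = U" using ex_mset by blast
  define P where "P = (\<lambda>i. (\<Sum>x\<leftarrow>take i xs. f x) mod int n)"
  have "P ` {0..n} \<subseteq> {0..<int n}" using n by (auto simp: P_def)
  then have "card (P ` {0..n}) \<le> n" using card_mono[of "{0..<int n}" "P ` {0..n}"] by simp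
  then have "\<not> inj_on P {0..n}" using card_image by fastforce
  then obtain i j where ij: "i < j" "j \<le> n" "P i = P j"
    unfolding inj_on_def by (metis atLeastAtMost_iff linorder_neqE_nat)
  define ys where "ys = drop i (take j xs)"
  have len: "length xs \<ge> n" using U xs by auto
  have tj: "take j xs = take i xs @ ys"
    unfolding ys_def using ij(1) by (metis append_take_drop_id less_imp_le min.absorb1 take_take)
  have "xs = take i xs @ ys @ drop j xs" using tj by (metis append.assoc append_take_drop_id)
  then have "U = mset (take i xs) + (mset ys + mset (drop j xs))" using xs by (metis mset_append)
  then have "mset ys \<subseteq># U" by simp
  moreover have "length ys = j - i" using ij len by (simp add: ys_def)
  moreover have "int n dvd (\<Sum>x\<in>#mset ys. f x)"
  proof -
    have "[(\<Sum>x\<leftarrow>take i xs. f x) + (\<Sum>x\<leftarrow>ys. f x) = (\<Sum>x\<leftarrow>take i xs. f x) + 0] (mod int n)"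
      using ij(3) tj by (simp add: P_def cong_def)
    then have "[(\<Sum>x\<leftarrow>ys. f x) = 0] (mod int n)" by (simp only: cong_add_lcancel)
    then show ?thesis by (simp add: cong_0_iff flip: sum_mset_sum_list)
  qed
  ultimately show ?thesis using ij by (intro exI[of _ "mset ys"]) auto
qed

text \<open>Take a largest zero-sum \<open>V\<close> within the upper bound. If it had fewer than
  \<open>t\<close> terms, \<open>n\<close> terms would remain and a zero-sum piece of at most
  \<open>n\<close> of them could be added.\<close>

lemma zero_sum_submultiset_of_size_about:
  fixes f :: "'a \<Rightarrow> int"
  assumes n: "n > 0" and t: "t \<le> size E - (n - 1)"
  shows "\<exists>V. V \<subseteq># E \<and> int n dvd (\<Sum>x\<in>#V. f x) \<and> t \<le> size V \<and> size V \<le> t + n - 1"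
proof -
  let ?P = "\<lambda>V. V \<subseteq># E \<and> int n dvd (\<Sum>x\<in>#V. f x) \<and> size V \<le> t + n - 1"
  have "?P {#}" by simp
  moreover have "\<forall>V. ?P V \<longrightarrow> size V < t + n" using n by auto
  ultimately obtain V where V: "?P V" "\<And>W. ?P W \<Longrightarrow> size W \<le> size V"
    using ex_has_greatest_nat[of ?P "{#}" size "t + n"] by blast
  have "t \<le> size V"
  proof (rule ccontr)
    assume "\<not> t \<le> size V"
    then have "size (E - V) \<ge> n" using t V(1) n by (simp add: size_Diff_submset)
    from zero_sum_submultiset[OF n this]
    obtain W where W: "W \<subseteq># E - V" "W \<noteq> {#}" "size W \<le> n" "int n dvd (\<Sum>x\<in>#W. f x)" by blast
    have "V + W \<subseteq># E" using W(1) V(1) by (metis subset_mset.add_diff_inverse subset_mset.add_left_mono)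
    then have "?P (V + W)" using W V(1) \<open>\<not> t \<le> size V\<close> by auto
    then show False using V(2) W(2) by (fastforce simp: nonempty_has_size)
  qed
  then show ?thesis using V(1) by blast
qed

section \<open>Taking one element from each of several pairs\<close>

text \<open>Written as a sum of sets of multisets, so that \<open>card_tws_plus\<close> applies pair
  by pair.\<close>

primrec selections :: "('a \<times> 'a) list \<Rightarrow> 'a multiset set" where
  "selections [] = {{#}}"
| "selections (z # zs) = {{#fst z#}, {#snd z#}} + selections zs"

lemma selections_size: "V \<in> selections ps \<Longrightarrow> size V = length ps"
  by (induction ps arbitrary: V) (auto simp: set_plus_def)

lemma selections_subset: "V \<in> selections ps \<Longrightarrow> V \<subseteq># pairs_mset ps"
proof (induction ps arbitrary: V)
  case (Cons z ps)
  then obtain W where W: "W \<in> selections ps" "V = add_mset (fst z) W \<or> V = add_mset (snd z) W"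
    by (auto simp: set_plus_def)
  have "{#fst z#} + W \<subseteq># {#fst z, snd z#} + pairs_mset ps" "{#snd z#} + W \<subseteq># {#fst z, snd z#} + pairs_mset ps"
    using Cons.IH[OF W(1)] by (intro subset_mset.add_mono; simp)+
  then show ?case using W(2) by (cases z) auto
qed auto

lemma selections_nonempty [simp]: "selections ps \<noteq> {}"
  by (induction ps) (auto simp: set_plus_def)

context twisted
begin

lemma card_tws_singletons:
  assumes "\<not> [wb x = wb y] (mod int n)"
  shows "card (tws {{#x#}, {#y#}}) \<ge> 2"
proof -
  have "{wb x mod int n, wb y mod int n} \<subseteq> tws {{#x#}, {#y#}}"
    unfolding tws_def
    using image_eqI[of "wb x mod int n" "\<lambda>xs. tw xs mod int n" "[x]"]
      image_eqI[of "wb y mod int n" "\<lambda>xs. tw xs mod int n" "[y]"] by auto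
  then have "card {wb x mod int n, wb y mod int n} \<le> card (tws {{#x#}, {#y#}})"
    by (intro card_mono) auto
  then show ?thesis using assms by (simp add: cong_def)
qed

text \<open>Provides the constant weight that \<open>card_tws_plus\<close> demands of its second
  summand.\<close>

lemma selections_asum:
  assumes "\<forall>(x, y) \<in> set ps. [wa x = wa y] (mod m)" "V \<in> selections ps"
  shows "[asum V = asum (mset (map fst ps))] (mod m)"
  using assms
proof (induction ps arbitrary: V)
  case (Cons z ps)
  then obtain W where W: "W \<in> selections ps" "V = add_mset (fst z) W \<or> V = add_mset (snd z) W"
    by (auto simp: set_plus_def)
  have "[asum W = asum (mset (map fst ps))] (mod m)" using Cons W by auto
  moreover have "[wa (snd z) = wa (fst z)] (mod m)" using Cons.prems by (auto intro: cong_sym)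
  ultimately show ?case using W(2) by (auto intro!: cong_add)
qed auto

text \<open>Each pair offers two exponents with the same weight, hence one more residue by
  \<open>card_tws_plus\<close>.\<close>

lemma card_tws_selections:
  assumes "\<forall>(x, y) \<in> set ps. [wa x = wa y] (mod m) \<and> \<not> [wb x = wb y] (mod int n)"
  shows "card (tws (selections ps)) \<ge> min n (length ps + 1)"
  using assms
proof (induction ps)
  case Nil
  then show ?case using card_tws_pos[of "selections []"] by simp
next
  case (Cons z ps)
  have "min n (card (tws {{#fst z#}, {#snd z#}}) + card (tws (selections ps)) - 1)
      \<le> card (tws (selections (z # ps)))"
    unfolding selections.simps
  proof (rule card_tws_plus[where c = "asum (mset (map fst ps))"])
    show "[asum N = asum (mset (map fst ps))] (mod m)" if "N \<in> selections ps" for N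
      using Cons.prems that by (intro selections_asum) auto
  qed auto
  moreover have "card (tws {{#fst z#}, {#snd z#}}) \<ge> 2"
    using Cons.prems by (intro card_tws_singletons) (auto simp: case_prod_beta)
  moreover have "min n (length ps + 1) \<le> card (tws (selections ps))" using Cons by auto
  ultimately show ?case by auto
qed

end

section \<open>Subsequences of prescribed length and sum; Erdos-Ginzburg-Ziv\<close>

text \<open>With \<open>s = 1\<close> and zero weights \<open>tw\<close> is the plain sum of
  \<open>f\<close>. The \<open>p - 1\<close> pairs then realize every sum, and a fixed filler
  \<open>R\<close> brings the length to \<open>M\<close>.\<close>

lemma choose_with_sum:
  fixes f :: "'a \<Rightarrow> int"
  assumes p: "prime p" and ps: "length ps = p - 1" "\<forall>(x, y) \<in> set ps. \<not> [f x = f y] (mod int p)"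
    "pairs_mset ps \<subseteq># Z" and M: "p - 1 \<le> M" "M + p - 1 \<le> size Z"
  shows "\<exists>V. V \<subseteq># Z \<and> size V = M \<and> [(\<Sum>x\<in>#V. f x) = c] (mod int p)"
proof -
  interpret twisted p 1 1 "\<lambda>_. 0" f by unfold_locales (use p in auto)
  have tw: "tw xs = (\<Sum>x\<in>#mset xs. f x)" for xs by (induction xs) auto
  have "M - (p - 1) \<le> size (Z - pairs_mset ps)"
    using M ps prime_gt_0_nat[OF p] by (simp add: size_Diff_submset)
  then obtain R where R: "R \<subseteq># Z - pairs_mset ps" "size R = M - (p - 1)" by (rule submultiset_of_size)
  have "min p (card (tws {R}) + card (tws (selections ps)) - 1) \<le> card (tws ({R} + selections ps))"
    by (rule card_tws_plus[where c = 0]) auto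
  moreover have "min p (length ps + 1) \<le> card (tws (selections ps))"
    using ps by (intro card_tws_selections) auto
  moreover have "card (tws {R}) \<ge> 1" by (rule card_tws_pos) simp
  ultimately have "card (tws ({R} + selections ps)) \<ge> p" using ps(1) prime_gt_0_nat[OF p] by simp
  then obtain xs where xs: "mset xs \<in> {R} + selections ps" "[tw xs = c] (mod int p)" by (rule tws_full)
  then obtain V where V: "V \<in> selections ps" "mset xs = R + V" by (auto simp: set_plus_def)
  have "R + V \<subseteq># (Z - pairs_mset ps) + pairs_mset ps"
    by (intro subset_mset.add_mono R selections_subset V)
  then have "R + V \<subseteq># Z" using ps(3) by simp
  then show ?thesis using V selections_size[OF V(1)] R M ps xs(2)
    by (intro exI[of _ "R + V"]) (simp add: tw)
qed

text \<open>Either \<open>M\<close> terms share a residue and their sum is \<open>M\<close> times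
  it, or no residue is frequent enough to prevent \<open>p - 1\<close> disjoint pairs with distinct
  residues.\<close>

lemma Erdos_Ginzburg_Ziv:
  fixes f :: "'a \<Rightarrow> int"
  assumes p: "prime p" and M: "p dvd M" "M > 0" "M + p - 1 \<le> size Z"
  shows "\<exists>V. V \<subseteq># Z \<and> size V = M \<and> int p dvd (\<Sum>x\<in>#V. f x)"
proof (cases "\<exists>v. M \<le> size {#z \<in># Z. f z mod int p = v#}")
  case True
  then obtain v where "M \<le> size {#z \<in># Z. f z mod int p = v#}" by blast
  then obtain V where V: "V \<subseteq># {#z \<in># Z. f z mod int p = v#}" "size V = M" by (rule submultiset_of_size)
  have sub: "V \<subseteq># Z" using V(1) multiset_filter_subset subset_mset.order_trans by blast
  have all: "f z mod int p = v" if "z \<in># V" for z using V(1) that by (auto dest: mset_subset_eqD)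
  have "[(\<Sum>x\<in>#W. f x) = int (size W) * v] (mod int p)" if "W \<subseteq># V" for W
    using that
  proof (induction W)
    case (add x W)
    then have "x \<in># V" by (simp add: insert_subset_eq_iff)
    then have "[f x = v] (mod int p)" using all[of x] by (metis cong_def mod_mod_trivial)
    moreover have "[(\<Sum>x\<in>#W. f x) = int (size W) * v] (mod int p)"
      using add by (metis subset_mset.dual_order.trans add_mset_add_single mset_subset_eq_add_left)
    ultimately show ?case by (auto simp: algebra_simps intro!: cong_add)
  qed auto
  from this[of V] have "[(\<Sum>x\<in>#V. f x) = int M * v] (mod int p)" using V(2) by simp
  moreover have "int p dvd int M * v" using M by simp
  ultimately have "int p dvd (\<Sum>x\<in>#V. f x)" using cong_dvd_iff by blast
  then show ?thesis using sub V(2) by blast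
next
  case False
  have "p \<le> M" using M by (auto dest: dvd_imp_le)
  have "p - 1 \<le> size {#z \<in># Z. f z mod int p \<noteq> v#}" for v
    using False[simplified, rule_format, of v] size_filter_compl[of "\<lambda>z. f z mod int p = v" Z] M by simp
  moreover have "2 * (p - 1) \<le> size Z" using \<open>p \<le> M\<close> M by simp
  ultimately obtain ps where "length ps = p - 1"
    "\<forall>(x, y) \<in> set ps. f x mod int p \<noteq> f y mod int p" "pairs_mset ps \<subseteq># Z"
    using disjoint_pairs_distinct_key[of "p - 1" Z "\<lambda>z. f z mod int p"] by blast
  then have "\<exists>V. V \<subseteq># Z \<and> size V = M \<and> [(\<Sum>x\<in>#V. f x) = 0] (mod int p)"
    using p M \<open>p \<le> M\<close> by (intro choose_with_sum[of p ps]) (auto simp: cong_def)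
  then show ?thesis by (simp add: cong_0_iff)
qed

section \<open>Product-one sequences\<close>

locale metacyclic = twisted q p s wa wb
  for q p :: nat and s :: int and wa :: "'a \<Rightarrow> nat" and wb :: "'a \<Rightarrow> int" +
  assumes prime_p: "prime p" and p_ge_3: "p \<ge> 3" and p_dvd: "p dvd q - 1"
    and order_s: "\<And>d. 0 < d \<Longrightarrow> d < p \<Longrightarrow> \<not> [s ^ d = 1] (mod int q)"
begin

text \<open>The exponent of \<open>x\<close> is the same for all orders of the terms; only that of
  \<open>y\<close> depends on the order.\<close>

definition product_one :: "'a multiset \<Rightarrow> bool" where
  "product_one M \<longleftrightarrow> p dvd asum M \<and> (\<exists>xs. mset xs = M \<and> int q dvd tw xs)"

text \<open>This is the equality of \<open>tw [x, y]\<close> and \<open>tw [y, x]\<close> modulo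
  \<open>q\<close>, rearranged.\<close>

definition comm :: "'a \<Rightarrow> 'a \<Rightarrow> bool" where
  "comm x y \<longleftrightarrow> [wb x * (s ^ wa y - 1) = wb y * (s ^ wa x - 1)] (mod int q)"

definition ident :: "'a \<Rightarrow> bool" where
  "ident x \<longleftrightarrow> p dvd wa x \<and> int q dvd wb x"

lemma prime_q_int: "prime (int q)"
  using prime_n by simp

lemma s_pow_eq_1_iff: "[s ^ a = 1] (mod int q) \<longleftrightarrow> p dvd a"
proof
  assume "[s ^ a = 1] (mod int q)"
  moreover have "[s ^ a = s ^ (a mod p)] (mod int q)" by (rule s_pow_cong) (simp add: cong_def)
  ultimately have "[s ^ (a mod p) = 1] (mod int q)" by (metis cong_sym cong_trans)
  then have "a mod p = 0" using order_s[of "a mod p"] m_pos by (meson gr0I mod_less_divisor)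
  then show "p dvd a" by auto
next
  assume "p dvd a"
  then have "[a = 0] (mod p)" by (simp add: cong_0_iff)
  then show "[s ^ a = 1] (mod int q)" using s_pow_cong by fastforce
qed

lemma q_dvd_s_pow_minus_1_iff: "int q dvd s ^ a - 1 \<longleftrightarrow> p dvd a"
  using s_pow_eq_1_iff by (simp add: cong_iff_dvd_diff)

lemma product_one_empty [simp]: "product_one {#}"
  by (auto simp: product_one_def)

lemma product_one_plus:
  assumes "product_one M" "product_one N" shows "product_one (M + N)"
proof -
  obtain xs ys where xy: "mset xs = M" "int q dvd tw xs" "mset ys = N" "int q dvd tw ys"
    using assms by (auto simp: product_one_def)
  then have "mset (xs @ ys) = M + N" "int q dvd tw (xs @ ys)" by (auto simp: tw_append)
  then show ?thesis using assms unfolding product_one_def by (metis asum_simps(3) dvd_add)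
qed

lemma card_tws_single_plus:
  "card (tws {M + N}) \<ge> min q (card (tws {M}) + card (tws {N}) - 1)"
  using card_tws_plus[of "{M}" "{N}" "asum N"] by (simp add: set_plus_def)

lemma product_one_of_full:
  assumes "q \<le> card (tws \<M>)" "\<And>M. M \<in> \<M> \<Longrightarrow> p dvd asum M"
  obtains M where "M \<in> \<M>" "product_one M"
proof -
  obtain xs where "mset xs \<in> \<M>" "[tw xs = 0] (mod int q)" using assms(1) by (rule tws_full)
  then show ?thesis using that assms(2) by (force simp: product_one_def cong_0_iff)
qed

text \<open>Adding terms never lowers the number of reachable exponents, and once all
  \<open>q\<close> residues are reached, \<open>0\<close> is among them.\<close>

lemma product_one_of_full_submset:
  assumes "M \<subseteq># T" "q \<le> card (tws {M})" "p dvd asum T"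
  shows "product_one T"
proof -
  have "T = M + (T - M)" using assms(1) by simp
  moreover have "card (tws {M + (T - M)}) \<ge> q"
    using card_tws_single_plus[of M "T - M"] assms(2) card_tws_pos[of "{T - M}"] by simp
  ultimately have "q \<le> card (tws {T})" by simp
  then show ?thesis using assms(3) by (auto elim: product_one_of_full[of "{T}"])
qed

lemma comm_sym: "comm x y \<longleftrightarrow> comm y x"
  by (auto simp: comm_def cong_sym_eq)

section \<open>Moving a term past copies of an element not commuting with it\<close>

lemma asum_replicate [simp]: "asum (replicate_mset k x) = k * wa x"
  by (induction k) auto

text \<open>The geometric sum for a power of \<open>g\<close>, cleared of its denominator.\<close>

lemma tw_replicate: "tw (replicate t g) * (s ^ wa g - 1) = wb g * (s ^ (t * wa g) - 1)"
  by (induction t) (auto simp: algebra_simps power_add)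

lemma tw_replicate_cong:
  assumes "p dvd wa g" shows "[tw (replicate t g) = int t * wb g] (mod int q)"
proof (induction t)
  case (Suc t)
  have "[s ^ (t * wa g) = 1] (mod int q)" using assms by (simp add: s_pow_eq_1_iff)
  then have "[s ^ (t * wa g) * wb g + tw (replicate t g) = 1 * wb g + int t * wb g] (mod int q)"
    by (intro cong_add cong_mult cong_refl Suc)
  then show ?case by (simp add: algebra_simps)
qed auto

text \<open>If \<open>u\<close> commuted with the \<open>t\<close>-th power of \<open>g\<close>, the
  defect in \<open>comm u g\<close> times a unit would vanish modulo \<open>q\<close>. The unit is
  \<open>t\<close> for \<open>g\<close> in \<open>N\<close> and \<open>s ^ (t * wa g) - 1\<close>
  otherwise.\<close>

lemma moving_past_powers:
  assumes nc: "\<not> comm u g" and t: "0 < t" "p dvd wa g \<Longrightarrow> t < q" "\<not> p dvd wa g \<Longrightarrow> t < p"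
  shows "\<not> [tw (u # replicate t g) = tw (replicate t g @ [u])] (mod int q)"
proof
  assume "[tw (u # replicate t g) = tw (replicate t g @ [u])] (mod int q)"
  then have dvd: "int q dvd wb u * (s ^ (t * wa g) - 1) - tw (replicate t g) * (s ^ wa u - 1)"
    by (simp add: tw_append cong_iff_dvd_diff algebra_simps)
  have nc': "\<not> int q dvd wb u * (s ^ wa g - 1) - wb g * (s ^ wa u - 1)"
    using nc by (simp add: comm_def cong_iff_dvd_diff)
  show False
  proof (cases "p dvd wa g")
    case True
    have "int q dvd wb u * (s ^ (t * wa g) - 1)" "int q dvd wb u * (s ^ wa g - 1)"
      using True by (simp_all add: q_dvd_s_pow_minus_1_iff)
    then have *: "int q dvd tw (replicate t g) * (s ^ wa u - 1)" "\<not> int q dvd wb g * (s ^ wa u - 1)"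
      using dvd nc' by (metis dvd_diff_right_iff, metis dvd_diff)
    have "[tw (replicate t g) * (s ^ wa u - 1) = int t * wb g * (s ^ wa u - 1)] (mod int q)"
      by (intro cong_mult tw_replicate_cong True cong_refl)
    then have "int q dvd int t * (wb g * (s ^ wa u - 1))"
      using *(1) cong_dvd_iff by (metis mult.assoc)
    then have "int q dvd int t" using *(2) prime_q_int prime_dvd_mult_iff by blast
    then show False using t True by (auto dest: dvd_imp_le)
  next
    case False
    have "int q dvd (wb u * (s ^ (t * wa g) - 1) - tw (replicate t g) * (s ^ wa u - 1)) * (s ^ wa g - 1)"
      using dvd by (rule dvd_mult2)
    also have "\<dots> = wb u * (s ^ (t * wa g) - 1) * (s ^ wa g - 1)
        - tw (replicate t g) * (s ^ wa g - 1) * (s ^ wa u - 1)" by (simp add: algebra_simps)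
    also have "\<dots> = (s ^ (t * wa g) - 1) * (wb u * (s ^ wa g - 1) - wb g * (s ^ wa u - 1))"
      unfolding tw_replicate by (simp add: algebra_simps)
    finally have "p dvd t * wa g"
      using nc' prime_q_int prime_dvd_mult_iff q_dvd_s_pow_minus_1_iff by blast
    then have "p dvd t" using False prime_p prime_dvd_mult_iff by blast
    then show False using t False by (auto dest: dvd_imp_le)
  qed
qed

text \<open>The order \<open>L i\<close> has \<open>u\<close> after \<open>i\<close> copies of
  \<open>g\<close>. Equal exponents for two of these \<open>j + 1\<close> orders would make
  \<open>u\<close> commute with a power of \<open>g\<close> excluded by
  \<open>moving_past_powers\<close>.\<close>

lemma card_tws_moving:
  assumes nc: "\<not> comm u g" and j: "p dvd wa g \<Longrightarrow> j < q" "\<not> p dvd wa g \<Longrightarrow> j < p"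
  shows "card (tws {add_mset u (replicate_mset j g)}) \<ge> j + 1"
proof -
  define L where "L = (\<lambda>i. replicate i g @ u # replicate (j - i) g)"
  have ne: "tw (L i) mod int q \<noteq> tw (L i') mod int q" if ii: "i < i'" "i' \<le> j" for i i'
  proof
    assume eq: "tw (L i) mod int q = tw (L i') mod int q"
    define t where "t = i' - i"
    have 1: "L i = replicate i g @ (u # replicate t g) @ replicate (j - i') g"
      unfolding L_def t_def using ii by (simp add: replicate_add[symmetric])
    have 2: "L i' = replicate i g @ (replicate t g @ [u]) @ replicate (j - i') g"
      unfolding L_def t_def using ii
      by (metis append.assoc append_Cons append_Nil le_add_diff_inverse less_imp_le replicate_add)
    have "[s ^ ((j - i') * wa g) * tw (u # replicate t g) = s ^ ((j - i') * wa g) * tw (replicate t g @ [u])] (mod int q)"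
    proof -
      have "[tw (L i) = tw (L i')] (mod int q)" using eq by (simp add: cong_def)
      moreover have "tw (L i) = s ^ asum (mset (u # replicate t g @ replicate (j - i') g)) * tw (replicate i g)
          + (s ^ ((j - i') * wa g) * tw (u # replicate t g) + tw (replicate (j - i') g))"
        unfolding 1 tw_append[of "replicate i g"] tw_append[of "u # replicate t g"] by simp
      moreover have "tw (L i') = s ^ asum (mset (u # replicate t g @ replicate (j - i') g)) * tw (replicate i g)
          + (s ^ ((j - i') * wa g) * tw (replicate t g @ [u]) + tw (replicate (j - i') g))"
        unfolding 2 tw_append[of "replicate i g"] tw_append[of "replicate t g @ [u]"] by (simp add: add_ac)
      ultimately show ?thesis by (simp only: cong_add_lcancel cong_add_rcancel)
    qed
    then have "[tw (u # replicate t g) = tw (replicate t g @ [u])] (mod int q)"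
      using coprime_s by (simp add: cong_mult_lcancel)
    moreover have "0 < t" "p dvd wa g \<Longrightarrow> t < q" "\<not> p dvd wa g \<Longrightarrow> t < p"
      using ii j unfolding t_def by auto
    ultimately show False using moving_past_powers[OF nc] by blast
  qed
  have "inj_on (\<lambda>i. tw (L i) mod int q) {0..j}"
    using ne by (intro linorder_inj_onI) auto
  then have "card ((\<lambda>i. tw (L i) mod int q) ` {0..j}) = j + 1" by (simp add: card_image)
  moreover have "(\<lambda>i. tw (L i) mod int q) ` {0..j} \<subseteq> tws {add_mset u (replicate_mset j g)}"
  proof (clarify)
    fix i assume "i \<in> {0..j}"
    then have "mset (L i) = add_mset u (replicate_mset j g)"
      unfolding L_def by (intro multiset_eqI) auto
    then show "tw (L i) mod int q \<in> tws {add_mset u (replicate_mset j g)}" unfolding tws_def by blast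
  qed
  ultimately show ?thesis by (metis card_mono finite_tws)
qed

text \<open>Each term of \<open>U\<close> takes along up to \<open>p - 1\<close> copies of
  \<open>g\<close>, the most that \<open>card_tws_moving\<close> allows for \<open>g\<close> outside
  \<open>N\<close>, and gains one exponent per copy.\<close>

lemma card_tws_moving_many:
  assumes "\<forall>u \<in># U. \<not> comm u g" "\<not> p dvd wa g" "k \<le> (p - 1) * size U"
  shows "card (tws {U + replicate_mset k g}) \<ge> min q (k + 1)"
  using assms(1,3)
proof (induction U arbitrary: k)
  case empty
  then show ?case using card_tws_pos[of "{{#}}"] by simp
next
  case (add u U)
  define j where "j = min k (p - 1)"
  have "j \<le> k" by (simp add: j_def)
  have combine: "min q (k + 1) \<le> c" if "j \<le> k" "min q (k - j + 1) \<le> b" "j + 1 \<le> a" "min q (a + b - 1) \<le> c"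
    for a b c using that by linarith
  have "card (tws {U + replicate_mset (k - j) g}) \<ge> min q (k - j + 1)"
    using add by (intro add.IH) (auto simp: j_def)
  moreover have "card (tws {add_mset u (replicate_mset j g)}) \<ge> j + 1"
    using add.prems(1) assms(2) p_ge_3 by (intro card_tws_moving) (auto simp: j_def)
  moreover have "add_mset u (replicate_mset j g) + (U + replicate_mset (k - j) g)
      = add_mset u U + replicate_mset k g"
    by (intro multiset_eqI) (auto simp: j_def)
  ultimately show ?case
    using card_tws_single_plus[of "add_mset u (replicate_mset j g)" "U + replicate_mset (k - j) g"]
      combine[OF \<open>j \<le> k\<close>] by metis
qed

lemma card_tws_pairs:
  assumes "\<forall>(x, y) \<in> set ps. \<not> comm x y"
  shows "card (tws {pairs_mset ps}) \<ge> min q (length ps + 1)"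
  using assms
proof (induction ps)
  case Nil
  then show ?case using card_tws_pos[of "{{#}}"] by simp
next
  case (Cons z ps)
  obtain x y where z: "z = (x, y)" by (cases z)
  have "q > 1" using prime_n prime_gt_1_nat by blast
  then have "card (tws {add_mset x (replicate_mset 1 y)}) \<ge> 1 + 1"
    using Cons.prems z p_ge_3 by (intro card_tws_moving) auto
  then show ?case using card_tws_single_plus[of "{#x, y#}" "pairs_mset ps"] Cons z by simp
qed

section \<open>Terms in the centralizer of an element outside \<open>N\<close>\<close>

text \<open>The centralizer of \<open>g\<close> is a complement of \<open>N\<close>, so a product of
  its elements that lies in \<open>N\<close> equals \<open>1\<close>. The proof shows that the
  exponents of such a product stay parallel to those of \<open>g\<close>.\<close>

lemma product_one_in_centralizer:
  assumes g: "\<not> p dvd wa g" and M: "p dvd asum M" "\<And>x. x \<in># M \<Longrightarrow> comm x g"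
  shows "product_one M"
proof -
  obtain xs where xs: "mset xs = M" using ex_mset by blast
  have "[tw ys * (s ^ wa g - 1) = wb g * (s ^ asum (mset ys) - 1)] (mod int q)"
    if "\<forall>y \<in> set ys. comm y g" for ys
    using that
  proof (induction ys)
    case (Cons y ys)
    have "[s ^ asum (mset ys) * (wb y * (s ^ wa g - 1)) + tw ys * (s ^ wa g - 1)
        = s ^ asum (mset ys) * (wb g * (s ^ wa y - 1)) + wb g * (s ^ asum (mset ys) - 1)] (mod int q)"
      using Cons by (intro cong_add cong_scalar_left) (auto simp: comm_def)
    then show ?case by (simp add: algebra_simps power_add)
  qed auto
  from this[of xs] have "[tw xs * (s ^ wa g - 1) = wb g * (s ^ asum M - 1)] (mod int q)"
    using xs M(2) by (metis set_mset_mset)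
  moreover have "int q dvd wb g * (s ^ asum M - 1)" using M(1) by (simp add: q_dvd_s_pow_minus_1_iff)
  ultimately have "int q dvd tw xs * (s ^ wa g - 1)" using cong_dvd_iff by blast
  then have "int q dvd tw xs" using g prime_q_int by (simp add: prime_dvd_mult_iff q_dvd_s_pow_minus_1_iff)
  then show ?thesis using xs M(1) by (auto simp: product_one_def)
qed

lemma int_asum: "int (asum M) = (\<Sum>x\<in>#M. int (wa x))"
  by (induction M) auto

lemma product_one_large_centralizer:
  assumes g: "\<not> p dvd wa g" and l: "p dvd l" "l > 0" "l + p - 1 \<le> size {#x \<in># S. comm x g#}"
  shows "\<exists>T. T \<subseteq># S \<and> size T = l \<and> product_one T"
proof -
  obtain T where T: "T \<subseteq># {#x \<in># S. comm x g#}" "size T = l" "int p dvd (\<Sum>x\<in>#T. int (wa x))"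
    using Erdos_Ginzburg_Ziv[OF prime_p l] by blast
  then have "p dvd asum T" using int_asum by (metis int_dvd_int_iff)
  moreover have "comm x g" if "x \<in># T" for x using T(1) that by (auto dest: mset_subset_eqD)
  ultimately have "product_one T" by (intro product_one_in_centralizer[OF g])
  then show ?thesis using T multiset_filter_subset subset_mset.order_trans by blast
qed

section \<open>Minimal blocks and nonempty product-one subsequences\<close>

text \<open>Rotating a block multiplies its exponent by \<open>s\<close> to the weight of the prefix
  moved. By minimality no proper segment has weight divisible by \<open>p\<close>, so these powers
  of \<open>s\<close> are distinct.\<close>

lemma card_tws_minimal_block:
  assumes W: "W \<noteq> {#}" "p dvd asum W" "\<forall>V. V \<subset># W \<and> V \<noteq> {#} \<longrightarrow> \<not> p dvd asum V"
    and no: "\<not> product_one W"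
  shows "card (tws {W}) \<ge> size W" "0 \<notin> tws {W}"
proof -
  show nz: "0 \<notin> tws {W}"
    using no W(2) by (auto simp: tws_def product_one_def dvd_eq_mod_eq_0)
  obtain xs where xs: "mset xs = W" using ex_mset by blast
  define L where "L = (\<lambda>i. drop i xs @ take i xs)"
  have mL: "mset (L i) = W" for i
    unfolding L_def using xs by (metis append_take_drop_id mset_append union_commute)
  have twL: "[tw (L i) = s ^ asum (mset (take i xs)) * tw xs] (mod int q)" for i
  proof -
    let ?u = "take i xs" and ?v = "drop i xs"
    have W_eq: "asum (mset ?u) + asum (mset ?v) = asum W"
      using xs by (metis append_take_drop_id asum_simps(3) mset_append)
    have "tw xs = s ^ asum (mset ?v) * tw ?u + tw ?v" by (metis append_take_drop_id tw_append)
    then have "s ^ asum (mset ?u) * tw xs = s ^ asum W * tw ?u + s ^ asum (mset ?u) * tw ?v"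
      by (simp add: W_eq[symmetric] power_add algebra_simps)
    moreover have "[s ^ asum W * tw ?u + s ^ asum (mset ?u) * tw ?v = 1 * tw ?u + s ^ asum (mset ?u) * tw ?v] (mod int q)"
      using W(2) by (intro cong_add cong_mult cong_refl) (simp add: s_pow_eq_1_iff)
    ultimately show ?thesis by (simp add: L_def tw_append cong_sym_eq add.commute)
  qed
  have ne: "tw (L i) mod int q \<noteq> tw (L j) mod int q" if ij: "i < j" "j < length xs" for i j
  proof
    assume "tw (L i) mod int q = tw (L j) mod int q"
    then have "[s ^ asum (mset (take i xs)) * tw xs = s ^ asum (mset (take j xs)) * tw xs] (mod int q)"
      using twL by (metis cong_def)
    define ys where "ys = drop i (take j xs)"
    have tj: "take j xs = take i xs @ ys"
      unfolding ys_def using ij(1) by (metis append_take_drop_id less_imp_le min.absorb1 take_take)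
    have "tw xs * (s ^ asum (mset (take j xs)) - s ^ asum (mset (take i xs)))
        = s ^ asum (mset (take i xs)) * (tw xs * (s ^ asum (mset ys) - 1))"
      unfolding tj by (simp add: power_add algebra_simps)
    moreover have "int q dvd tw xs * (s ^ asum (mset (take j xs)) - s ^ asum (mset (take i xs)))"
      using \<open>[s ^ asum (mset (take i xs)) * tw xs = _] (mod int q)\<close>
      by (simp add: cong_iff_dvd_diff algebra_simps dvd_diff_commute)
    moreover have "\<not> int q dvd tw xs" using no xs W(2) by (auto simp: product_one_def)
    moreover have "\<not> int q dvd s ^ asum (mset (take i xs))"
      using coprime_s prime_q_int by (meson coprime_common_divisor dvd_refl not_prime_unit prime_dvd_power)
    ultimately have "p dvd asum (mset ys)"
      using prime_q_int by (metis prime_dvd_mult_iff q_dvd_s_pow_minus_1_iff)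
    have "xs = take i xs @ ys @ drop j xs" using tj by (metis append.assoc append_take_drop_id)
    then have "W = mset (take i xs) + (mset ys + mset (drop j xs))" using xs by (metis mset_append)
    then have "mset ys \<subset># W" using ij by (simp add: subset_mset.less_le)
    moreover have "mset ys \<noteq> {#}" using ij by (simp add: ys_def)
    ultimately show False using W(3) \<open>p dvd asum (mset ys)\<close> by blast
  qed
  have "inj_on (\<lambda>i. tw (L i) mod int q) {0..<length xs}"
    using ne by (intro linorder_inj_onI) auto
  then have "card ((\<lambda>i. tw (L i) mod int q) ` {0..<length xs}) = size W"
    using xs by (simp add: card_image flip: size_mset)
  moreover have "(\<lambda>i. tw (L i) mod int q) ` {0..<length xs} \<subseteq> tws {W}"
    using mL by (auto simp: tws_def)
  ultimately show "card (tws {W}) \<ge> size W" by (metis card_mono finite_tws)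
qed

lemma minimal_block_exists:
  assumes "size U \<ge> p"
  obtains W where "W \<subseteq># U" "W \<noteq> {#}" "p dvd asum W"
    "\<forall>V. V \<subset># W \<and> V \<noteq> {#} \<longrightarrow> \<not> p dvd asum V"
proof -
  let ?P = "\<lambda>W. W \<subseteq># U \<and> W \<noteq> {#} \<and> p dvd asum W"
  obtain W0 where "?P W0"
    using zero_sum_submultiset[OF m_pos assms, of "\<lambda>x. int (wa x)"] int_asum by (metis int_dvd_int_iff)
  then obtain W where W: "?P W" "\<And>V. ?P V \<Longrightarrow> size W \<le> size V"
    using ex_has_least_nat[of ?P W0 size] by blast
  have "\<not> p dvd asum V" if "V \<subset># W" "V \<noteq> {#}" for V
    using W(2)[of V] that W(1) mset_subset_size[OF that(1)]
    by (auto dest: subset_mset.order_trans[OF subset_mset.less_imp_le])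
  then show ?thesis using that W(1) by blast
qed

text \<open>Split off a minimal block \<open>W\<close>. Omitting it gives the exponent
  \<open>0\<close>, its rotations give \<open>size W\<close> nonzero ones, so each block adds
  \<open>size W\<close> until fewer than \<open>p\<close> terms remain.\<close>

lemma card_tws_zero_sums:
  assumes "\<And>V. V \<subseteq># U \<Longrightarrow> V \<noteq> {#} \<Longrightarrow> \<not> product_one V"
  shows "card (tws {V. V \<subseteq># U \<and> p dvd asum V}) \<ge> min q (size U + 2 - p)"
  using assms
proof (induction "size U" arbitrary: U rule: less_induct)
  case less
  let ?\<M> = "\<lambda>U. {V. V \<subseteq># U \<and> p dvd asum V}"
  have ne: "?\<M> V \<noteq> {}" for V by (metis (mono_tags) Collect_empty_eq asum_simps(1) dvd_0_right empty_le)
  show ?case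
  proof (cases "size U < p")
    case True
    then show ?thesis using card_tws_pos[OF ne[of U]] by auto
  next
    case False
    then have "p \<le> size U" by simp
    then obtain W where W: "W \<subseteq># U" "W \<noteq> {#}" "p dvd asum W"
      "\<forall>V. V \<subset># W \<and> V \<noteq> {#} \<longrightarrow> \<not> p dvd asum V"
      by (rule minimal_block_exists)
    have no: "\<not> product_one W" using less.prems W by blast
    have szW: "0 < size W" "size W \<le> size U" using W by (auto simp: nonempty_has_size size_mset_mono)
    have IH: "card (tws (?\<M> (U - W))) \<ge> min q (size (U - W) + 2 - p)"
      using szW W(1) less.prems by (intro less.hyps) (auto simp: size_Diff_submset intro: subset_mset.order_trans[OF _ diff_subset_eq_self])
    have "insert 0 (tws {W}) \<subseteq> tws {{#}, W}"
      unfolding tws_def using image_eqI[of 0 "\<lambda>xs. tw xs mod int q" "[]"] by auto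
    then have "card (insert 0 (tws {W})) \<le> card (tws {{#}, W})" by (intro card_mono) auto
    then have 2: "card (tws {{#}, W}) \<ge> size W + 1"
      using card_tws_minimal_block[OF W(2,3,4) no] by simp
    have "?\<M> (U - W) + {{#}, W} \<subseteq> ?\<M> U"
    proof
      fix X assume "X \<in> ?\<M> (U - W) + {{#}, W}"
      then obtain V where V: "V \<subseteq># U - W" "p dvd asum V" "X = V \<or> X = V + W"
        by (auto simp: set_plus_def)
      have "V + W \<subseteq># U" using V(1) W(1) by (metis subset_mset.add_right_mono subset_mset.diff_add)
      moreover have "V \<subseteq># U" using \<open>V + W \<subseteq># U\<close> by (meson mset_subset_eq_add_left subset_mset.order_trans)
      ultimately show "X \<in> ?\<M> U" using V W(3) by auto
    qed
    then have "card (tws (?\<M> (U - W) + {{#}, W})) \<le> card (tws (?\<M> U))"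
      by (intro card_mono tws_mono) auto
    moreover have "min q (card (tws (?\<M> (U - W))) + card (tws {{#}, W}) - 1) \<le> card (tws (?\<M> (U - W) + {{#}, W}))"
      by (rule card_tws_plus[where c = 0]) (use ne W(3) in \<open>auto simp: cong_0_iff\<close>)
    moreover have "min q (l + 2 - p) \<le> d"
      if "min q (a + b - 1) \<le> c" "c \<le> d" "min q (l - w + 2 - p) \<le> a" "1 \<le> a" "w + 1 \<le> b" "w \<le> l"
      for a b c d l w using that by linarith
    ultimately show ?thesis
      using IH 2 szW(2) card_tws_pos[OF ne[of "U - W"]] unfolding size_Diff_submset[OF W(1)] by blast
  qed
qed

text \<open>One minimal block \<open>W\<close> is always included, which makes the result nonempty.
  This loses the exponent \<open>0\<close> of the empty choice, and the length
  \<open>p + q - 1\<close> makes up for it.\<close>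

lemma small_davenport:
  assumes "size U \<ge> p + q - 1"
  shows "\<exists>V. V \<subseteq># U \<and> V \<noteq> {#} \<and> product_one V"
proof (rule ccontr)
  let ?\<M> = "\<lambda>U. {V. V \<subseteq># U \<and> p dvd asum V}"
  assume "\<not> ?thesis"
  then have no: "\<And>V. V \<subseteq># U \<Longrightarrow> V \<noteq> {#} \<Longrightarrow> \<not> product_one V" by blast
  have "p \<le> size U" using assms prime_gt_0_nat[OF prime_n] by simp
  then obtain W where W: "W \<subseteq># U" "W \<noteq> {#}" "p dvd asum W"
    "\<forall>V. V \<subset># W \<and> V \<noteq> {#} \<longrightarrow> \<not> p dvd asum V"
    by (rule minimal_block_exists)
  have szW: "0 < size W" "size W \<le> size U" using W by (auto simp: nonempty_has_size size_mset_mono)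
  have "card (tws (?\<M> (U - W))) \<ge> min q (size (U - W) + 2 - p)"
    using no by (intro card_tws_zero_sums) (auto intro: subset_mset.order_trans[OF _ diff_subset_eq_self])
  moreover have "card (tws {W}) \<ge> size W"
    using card_tws_minimal_block(1)[OF W(2,3,4)] no W by blast
  moreover have "min q (card (tws (?\<M> (U - W))) + card (tws {W}) - 1) \<le> card (tws (?\<M> (U - W) + {W}))"
  proof (rule card_tws_plus[where c = 0])
    show "?\<M> (U - W) \<noteq> {}" by (metis (mono_tags) Collect_empty_eq asum_simps(1) dvd_0_right empty_le)
  qed (use W(3) in \<open>auto simp: cong_0_iff\<close>)
  ultimately have "q \<le> card (tws (?\<M> (U - W) + {W}))"
    using assms szW W(1) by (simp add: size_Diff_submset min_def split: if_splits)
  then obtain M where M: "M \<in> ?\<M> (U - W) + {W}" "product_one M"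
    by (rule product_one_of_full) (use W(3) in \<open>auto simp: set_plus_def\<close>)
  then obtain V where "M = V + W" "V \<subseteq># U - W" by (auto simp: set_plus_def)
  then have "M \<subseteq># U" "M \<noteq> {#}" using W(1,2) by (auto simp: subset_mset.le_diff_conv2)
  then show False using no M(2) by blast
qed

text \<open>A largest product-one \<open>V\<close> among the other terms misses at most
  \<open>p + q - 2\<close> of them by \<open>small_davenport\<close>; identities fill it up to
  length \<open>l\<close>.\<close>

lemma product_one_many_idents:
  assumes S: "size S = l + p + q - 2" and h: "p + q - 2 \<le> size (filter_mset ident S)"
  shows "\<exists>T. T \<subseteq># S \<and> size T = l \<and> product_one T"
proof -
  define I where "I = filter_mset ident S"
  define U where "U = filter_mset (\<lambda>x. \<not> ident x) S"
  have q: "q \<ge> 2" using prime_n prime_ge_2_nat by blast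
  have SIU: "S = I + U" unfolding I_def U_def by (rule multiset_partition)
  let ?P = "\<lambda>V. V \<subseteq># U \<and> product_one V"
  have "?P {#}" by simp
  moreover have "\<forall>V. ?P V \<longrightarrow> size V < Suc (size U)" by (auto simp: size_mset_mono less_Suc_eq_le)
  ultimately obtain V where V: "?P V" "\<And>W. ?P W \<Longrightarrow> size W \<le> size V"
    using ex_has_greatest_nat[of ?P "{#}" size "Suc (size U)"] by blast
  have "size (U - V) < p + q - 1"
  proof (rule ccontr)
    assume "\<not> size (U - V) < p + q - 1"
    then obtain W where W: "W \<subseteq># U - V" "W \<noteq> {#}" "product_one W" using small_davenport[of "U - V"] by auto
    have "?P (V + W)" using W V(1) product_one_plus by (auto simp: subset_mset.le_diff_conv2 add.commute)
    then show False using V(2) W(2) by (fastforce simp: nonempty_has_size)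
  qed
  then have szV: "size U \<le> size V + (p + q - 2)" "size V \<le> size U"
    using V(1) by (auto simp: size_Diff_submset size_mset_mono)
  have szS: "size I + size U = l + p + q - 2" using S SIU by (metis size_union)
  \<comment> \<open>By the number of identities, at most \<open>l\<close> terms are left for
    \<open>U\<close>.\<close>
  have Vl: "size V \<le> l" using szV szS h q by (simp add: I_def)
  have "l - size V \<le> size I" using szV szS q p_ge_3 by simp
  then obtain R where R: "R \<subseteq># I" "size R = l - size V" by (rule submultiset_of_size)
  have id: "ident x" if "x \<in># R" for x using R(1) that by (auto simp: I_def dest: mset_subset_eqD)
  have "p dvd asum (mset ys) \<and> int q dvd tw ys" if "\<forall>y \<in> set ys. ident y" for ys
    using that by (induction ys) (auto simp: ident_def)
  then have "product_one R" using id ex_mset[of R] by (metis product_one_def set_mset_mset)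
  then have "product_one (V + R)" using V(1) product_one_plus by blast
  moreover have "V + R \<subseteq># S" using R(1) V(1) SIU by (metis add.commute subset_mset.add_mono)
  ultimately show ?thesis using R(2) Vl by (intro exI[of _ "V + R"]) auto
qed

section \<open>Commutation as an equivalence relation\<close>

text \<open>Since \<open>p\<close> is odd, \<open>q = p + 1\<close> would be even, so
  \<open>q - 1\<close> is at least twice \<open>p\<close>.\<close>

lemma q_ge: "2 * p + 1 \<le> q"
proof -
  obtain t where t: "q - 1 = p * t" using p_dvd by blast
  have q: "q \<ge> 2" using prime_n prime_ge_2_nat by blast
  have "t \<noteq> 0" using t q by (cases "t = 0") auto
  moreover have "t \<noteq> 1"
  proof
    assume "t = 1"
    then have "q = p + 1" using t q by simp
    moreover have "odd p" using prime_p p_ge_3 prime_odd_nat by auto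
    ultimately have "even q" "q > 2" using p_ge_3 by auto
    then show False using prime_n prime_odd_nat by blast
  qed
  ultimately have "p * 2 \<le> p * t" by (intro mult_le_mono2) simp
  then show ?thesis using t q by linarith
qed

lemma comm_refl [simp]: "comm x x"
  by (simp add: comm_def)

lemma comm_ident: "ident x \<Longrightarrow> comm x y"
  by (simp add: comm_def ident_def cong_iff_dvd_diff q_dvd_s_pow_minus_1_iff)

text \<open>\<open>comm x y\<close> says that the vectors \<open>(wb x, s ^ wa x - 1)\<close> and \<open>(wb y, s ^ wa y - 1)\<close>
  over the field of \<open>q\<close> elements are parallel.\<close>

lemma comm_trans:
  assumes "\<not> ident y" "comm x y" "comm y z" shows "comm x z"
proof -
  define t where "t = (\<lambda>x. s ^ wa x - 1)"
  let ?D = "wb x * t z - wb z * t x"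
  have xy: "int q dvd wb x * t y - wb y * t x" and yz: "int q dvd wb y * t z - wb z * t y"
    using assms by (simp_all add: comm_def cong_iff_dvd_diff t_def)
  have "wb y * ?D = wb x * (wb y * t z - wb z * t y) + wb z * (wb x * t y - wb y * t x)"
    "t y * ?D = t z * (wb x * t y - wb y * t x) + t x * (wb y * t z - wb z * t y)"
    by (simp_all add: algebra_simps)
  then have "int q dvd wb y * ?D" "int q dvd t y * ?D" using xy yz by (metis dvd_add dvd_mult)+
  moreover have "\<not> int q dvd wb y \<or> \<not> int q dvd t y"
    using assms(1) by (simp add: ident_def t_def q_dvd_s_pow_minus_1_iff) blast
  ultimately have "int q dvd ?D" using prime_q_int prime_dvd_mult_iff by blast
  then show ?thesis by (simp add: comm_def cong_iff_dvd_diff t_def)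
qed

text \<open>Modulo \<open>q\<close> the factor \<open>s ^ wa y - 1\<close> vanishes and
  \<open>wb y\<close> is invertible, so only the weight of \<open>x\<close> matters.\<close>

lemma comm_kernel_iff:
  assumes "p dvd wa y" "\<not> ident y" shows "comm x y \<longleftrightarrow> p dvd wa x"
proof -
  have nb: "\<not> int q dvd wb y" and d: "int q dvd wb x * (s ^ wa y - 1)"
    using assms by (auto simp: ident_def q_dvd_s_pow_minus_1_iff)
  have "comm x y \<longleftrightarrow> int q dvd wb x * (s ^ wa y - 1) - wb y * (s ^ wa x - 1)"
    by (simp add: comm_def cong_iff_dvd_diff)
  also have "\<dots> \<longleftrightarrow> int q dvd wb y * (s ^ wa x - 1)" using d by (rule dvd_diff_right_iff)
  also have "\<dots> \<longleftrightarrow> p dvd wa x" using nb prime_q_int by (simp add: prime_dvd_mult_iff q_dvd_s_pow_minus_1_iff)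
  finally show ?thesis .
qed

text \<open>At most \<open>q - 1\<close> terms outside the centralizer leave in it the
  \<open>p * q + p - 1\<close> terms that Erdos-Ginzburg-Ziv requires.\<close>

lemma product_one_small_noncentralizer:
  assumes "size S = p * q + p + q - 2" "\<not> p dvd wa g" "size {#x \<in># S. \<not> comm x g#} < q"
  shows "\<exists>T. T \<subseteq># S \<and> size T = p * q \<and> product_one T"
proof (rule product_one_large_centralizer[OF assms(2)])
  show "p * q + p - 1 \<le> size {#x \<in># S. comm x g#}"
    using assms(1,3) size_filter_compl[of "\<lambda>x. comm x g" S] p_ge_3 q_ge by linarith
  show "0 < p * q" using p_ge_3 q_ge by simp
qed simp

section \<open>Weights spread over several cosets of \<open>N\<close>\<close>

text \<open>Disjoint non-commuting pairs, \<open>q - 1\<close> of them, reach every exponent of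
  \<open>y\<close>; then \<open>p - 1\<close> pairs with distinct weights adjust the exponent of
  \<open>x\<close> at the right length.\<close>

lemma product_one_spread:
  assumes S: "size S = p * q + p + q - 2"
    and spread: "\<And>v. p + 2 * q - 3 \<le> size {#x \<in># S. wa x mod p \<noteq> v#}"
  shows "\<exists>T. T \<subseteq># S \<and> size T = p * q \<and> product_one T"
proof (cases "\<exists>g. \<not> p dvd wa g \<and> size {#x \<in># S. \<not> comm x g#} < q")
  case True
  then show ?thesis using product_one_small_noncentralizer[OF S] by blast
next
  case False
  note p3 = p_ge_3 and q7 = q_ge
  define S1 where "S1 = {#x \<in># S. \<not> ident x#}"
  \<comment> \<open>Among non-identity terms commuting is transitive by \<open>comm_trans\<close>,
    and \<open>key\<close> sends a term to its class.\<close>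
  define key where "key = (\<lambda>x. {y \<in> set_mset S1. comm x y})"
  have S1: "S1 \<subseteq># S" by (simp add: S1_def)
  have outer: "{#x \<in># S. wa x mod p \<noteq> 0#} \<subseteq># S1"
    unfolding S1_def by (intro filter_mset_mono_strong) (auto simp: ident_def)
  have szS1: "p + 2 * q - 3 \<le> size S1" using spread[of 0] size_mset_mono[OF outer] by simp
  have "q - 1 \<le> size {#z \<in># S1. key z \<noteq> v#}" for v
  proof (cases "\<exists>z. z \<in># S1 \<and> key z = v")
    case False
    then have "{#z \<in># S1. key z \<noteq> v#} = S1" by (auto simp: filter_mset_eq_conv)
    then show ?thesis using szS1 p3 q7 by simp
  next
    case True
    then obtain z where z: "z \<in># S1" "key z = v" by blast
    have "{#x \<in># S. \<not> comm x z#} = {#x \<in># S1. \<not> comm x z#}"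
      unfolding S1_def filter_filter_mset using comm_ident by (intro filter_mset_cong refl) auto
    also have "\<dots> \<subseteq># {#x \<in># S1. key x \<noteq> v#}"
    proof (intro filter_mset_mono_strong subset_mset.order_refl)
      fix x assume "\<not> comm x z"
      then have "z \<notin> key x" by (simp add: key_def)
      moreover have "z \<in> key z" using z(1) by (simp add: key_def)
      ultimately show "key x \<noteq> v" using z(2) by metis
    qed
    finally have le: "size {#x \<in># S. \<not> comm x z#} \<le> size {#x \<in># S1. key x \<noteq> v#}" by (rule size_mset_mono)
    \<comment> \<open>For \<open>z\<close> in \<open>N\<close> the terms not commuting with it are
      those outside \<open>N\<close>, counted by \<open>spread\<close>; for other \<open>z\<close>
      the current case gives at least \<open>q\<close> of them.\<close>
    show ?thesis
    proof (cases "p dvd wa z")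
      case True
      have "\<not> ident z" using z by (simp add: S1_def)
      then have "{#x \<in># S. \<not> comm x z#} = {#x \<in># S. wa x mod p \<noteq> 0#}"
        using True by (intro filter_mset_cong) (auto simp: comm_kernel_iff mod_greater_zero_iff_not_dvd)
      then show ?thesis using le spread[of 0] p3 by simp
    next
      case f: False
      then have "q \<le> size {#x \<in># S. \<not> comm x z#}" using False by (meson not_less)
      then show ?thesis using le by simp
    qed
  qed
  moreover have "2 * (q - 1) \<le> size S1" using szS1 p3 by simp
  ultimately obtain ps where ps: "length ps = q - 1" "\<forall>(x, y) \<in> set ps. key x \<noteq> key y" "pairs_mset ps \<subseteq># S1"
    using disjoint_pairs_distinct_key[of "q - 1" S1 key] by blast
  have "\<not> comm x y" if xy: "(x, y) \<in> set ps" for x y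
  proof
    assume c: "comm x y"
    have "x \<in># pairs_mset ps" "y \<in># pairs_mset ps" using xy by (force simp: pairs_mset_def)+
    then have "x \<in># S1" "y \<in># S1" using ps(3) by (auto dest: mset_subset_eqD)
    then have "\<not> ident x" "\<not> ident y" by (auto simp: S1_def)
    then have "key x = key y" unfolding key_def using c comm_trans comm_sym by blast
    then show False using ps(2) xy by blast
  qed
  then have full: "q \<le> card (tws {pairs_mset ps})"
    using card_tws_pairs[of ps] ps(1) prime_gt_0_nat[OF prime_n] by auto
  have psS: "pairs_mset ps \<subseteq># S" using ps(3) S1 by (rule subset_mset.order_trans)
  define Z where "Z = S - pairs_mset ps"
  have szZ: "size Z = p * q + p + q - 2 - 2 * (q - 1)"
    using S psS ps(1) by (simp add: Z_def size_Diff_submset)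
  have pq: "3 * q \<le> p * q" using p3 by (intro mult_le_mono1)
  \<comment> \<open>The pairs in \<open>ps\<close> use \<open>2 * (q - 1)\<close> terms, which
    leaves \<open>p - 1\<close> of the \<open>p + 2 * q - 3\<close> terms of other weight.\<close>
  have "p - 1 \<le> size {#z \<in># Z. int (wa z) mod int p \<noteq> v#}" for v
  proof -
    have "{#x \<in># S. wa x mod p \<noteq> nat v#} = {#x \<in># Z. wa x mod p \<noteq> nat v#} + {#x \<in># pairs_mset ps. wa x mod p \<noteq> nat v#}"
      unfolding Z_def using psS by (metis filter_union_mset subset_mset.diff_add)
    then have "size {#x \<in># S. wa x mod p \<noteq> nat v#} \<le> size {#x \<in># Z. wa x mod p \<noteq> nat v#} + 2 * (q - 1)"
      using size_filter_mset_lesseq[of "\<lambda>x. wa x mod p \<noteq> nat v" "pairs_mset ps"] ps(1) by simp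
    moreover have "{#x \<in># Z. wa x mod p \<noteq> nat v#} \<subseteq># {#z \<in># Z. int (wa z) mod int p \<noteq> v#}"
      by (intro filter_mset_mono_strong) (auto simp flip: of_nat_mod)
    ultimately show ?thesis using size_mset_mono spread[of "nat v"] p3 q7 by fastforce
  qed
  moreover have "2 * (p - 1) \<le> size Z" using szZ pq p3 q7 by linarith
  ultimately obtain rs where rs: "length rs = p - 1"
    "\<forall>(x, y) \<in> set rs. int (wa x) mod int p \<noteq> int (wa y) mod int p" "pairs_mset rs \<subseteq># Z"
    using disjoint_pairs_distinct_key[of "p - 1" Z "\<lambda>z. int (wa z) mod int p"] by blast
  \<comment> \<open>\<open>V\<close> completes the pairs to length \<open>p * q\<close> and cancels
    their weight.\<close>
  have "\<exists>V. V \<subseteq># Z \<and> size V = p * q - 2 * (q - 1)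
      \<and> [(\<Sum>x\<in>#V. int (wa x)) = - int (asum (pairs_mset ps))] (mod int p)"
  proof (rule choose_with_sum[OF prime_p rs(1) _ rs(3)])
    show "p - 1 \<le> p * q - 2 * (q - 1)" using pq p3 q7 by linarith
    show "p * q - 2 * (q - 1) + p - 1 \<le> size Z" using szZ pq p3 q7 by linarith
  qed (use rs(2) in \<open>auto simp: cong_def\<close>)
  then obtain V where V: "V \<subseteq># Z" "size V = p * q - 2 * (q - 1)"
    "[int (asum V) = - int (asum (pairs_mset ps))] (mod int p)"
    by (auto simp: int_asum)
  have "int p dvd int (asum (pairs_mset ps + V))" using V(3) by (simp add: cong_iff_dvd_diff add.commute)
  then have "p dvd asum (pairs_mset ps + V)" by (simp only: int_dvd_int_iff)
  then have "product_one (pairs_mset ps + V)"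
    using full by (intro product_one_of_full_submset[of "pairs_mset ps"]) auto
  moreover have "pairs_mset ps + V \<subseteq># S" using V(1) psS
    unfolding Z_def by (metis add.commute subset_mset.le_diff_conv2)
  moreover have "size (pairs_mset ps + V) = p * q" 
    using V(2) ps(1) pq unfolding size_union size_pairs_mset by linarith
  ultimately show ?thesis by blast
qed

section \<open>Almost all terms in one coset of \<open>N\<close>\<close>

text \<open>Weights are measured relative to \<open>v\<close>: terms of \<open>F\<close> then count
  as zero, and the correction is \<open>v\<close> times a length divisible by
  \<open>p\<close>.\<close>

lemma asum_balanced:
  assumes E: "int p dvd (\<Sum>x\<in>#E. int (wa x) - int v)" and F: "\<And>x. x \<in># F \<Longrightarrow> wa x mod p = v"
    and size: "p dvd size E + size F"
  shows "p dvd asum (E + F)"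
proof -
  have gen: "int (asum M) = (\<Sum>x\<in>#M. int (wa x) - int v) + int (size M) * int v" for M
    by (induction M) (auto simp: algebra_simps)
  have "int p dvd (\<Sum>x\<in>#F. int (wa x) - int v)" using F
  proof (induction F)
    case (add x F)
    have "int v = int (wa x) mod int p" using add.prems[of x] by (simp flip: of_nat_mod)
    then have "int p dvd int (wa x) - int v" by simp
    then show ?case using add by auto
  qed auto
  then have "int p dvd (\<Sum>x\<in>#E. int (wa x) - int v) + (\<Sum>x\<in>#F. int (wa x) - int v)
      + int (size E + size F) * int v"
    using E size by (intro dvd_add dvd_mult2) (simp_all only: int_dvd_int_iff)
  also have "\<dots> = int (asum (E + F))" unfolding gen[of "E + F"] by (simp add: algebra_simps)
  finally show ?thesis by (simp only: int_dvd_int_iff)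
qed

text \<open>Moving one term past \<open>p - 1\<close> copies of \<open>g\<close> gains \<open>p - 1\<close> products, so \<open>r\<close> such terms reach all
  of \<open>N\<close>; the upper bound leaves \<open>r\<close> of them either inside or outside the coset of \<open>g\<close>.\<close>

lemma movers_bound:
  obtains r where "q - 1 \<le> (p - 1) * r" "2 * r + p \<le> q + 2"
proof -
  \<comment> \<open>This is the ceiling of \<open>(q - 1) / (p - 1)\<close>.\<close>
  define r where "r = (q + p - 3) div (p - 1)"
  note p3 = p_ge_3 and q7 = q_ge
  have p1: "p - 1 > 0" using p3 by simp
  have dm: "q + p - 3 = (p - 1) * r + (q + p - 3) mod (p - 1)" unfolding r_def by simp
  have "(q + p - 3) mod (p - 1) < p - 1" using p1 by simp
  then have lo: "q - 1 \<le> (p - 1) * r" using dm p3 q7 by linarith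
  have hi: "(p - 1) * r \<le> q + p - 3" using dm by linarith
  have "2 * r + p \<le> q + 2"
  proof (cases "p = 3")
    case True
    \<comment> \<open>For \<open>p = 3\<close> the estimate \<open>hi\<close> misses the bound by
      one; parity closes the gap.\<close>
    have "odd q" using prime_n q7 p3 prime_odd_nat by auto
    moreover have "2 * r \<le> q" using hi True by simp
    ultimately have "2 * r < q" by (metis dvd_triv_left le_neq_implies_less)
    then show ?thesis using True by simp
  next
    case False
    define i where "i = p - 4"
    define j where "j = q - (i + 6)"
    have i: "p = i + 4" and j: "q = i + 6 + j" using False p3 q7 by (simp_all add: i_def j_def)
    show ?thesis
    proof (rule ccontr)
      assume "\<not> ?thesis"
      then have "2 * r \<ge> j + 5" using i j by simp
      then have "(i + 3) * (j + 5) \<le> (i + 3) * (2 * r)" by (intro mult_le_mono2)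
      also have "\<dots> = 2 * ((p - 1) * r)" using i by simp
      also have "\<dots> \<le> 2 * (q + p - 3)" using hi by (rule mult_le_mono2)
      finally have "(i + 3) * (j + 5) \<le> 2 * (2 * i + j + 7)" using i j by simp
      then show False by (simp add: algebra_simps)
    qed
  qed
  then show ?thesis using that lo by blast
qed

text \<open>Terms of \<open>E\<close> enter only as a submultiset with relative weight zero, so any
  terms of \<open>F\<close> that complete it to length \<open>p * q\<close> give weight divisible by
  \<open>p\<close>. It remains to reach all exponents of \<open>y\<close>.\<close>

lemma product_one_concentrated:
  assumes S: "size S = p * q + p + q - 2"
    and inj: "\<And>x y. x \<in># S \<Longrightarrow> y \<in># S \<Longrightarrow> [wa x = wa y] (mod p) \<Longrightarrow> [wb x = wb y] (mod int q) \<Longrightarrow> x = y"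
    and conc: "size {#x \<in># S. wa x mod p \<noteq> v#} \<le> p + 2 * q - 4"
  shows "\<exists>T. T \<subseteq># S \<and> size T = p * q \<and> product_one T"
proof -
  note p3 = p_ge_3 and q7 = q_ge
  have pq: "2 * p + 3 * q \<le> p * q + 6"
  proof -
    obtain i where i: "p = 3 + i" using p3 le_Suc_ex by blast
    have "2 * i \<le> q * i" using q7 p3 by (intro mult_le_mono1) simp
    then show ?thesis using i by (simp add: algebra_simps)
  qed
  define F where "F = {#x \<in># S. wa x mod p = v#}"
  define E where "E = {#x \<in># S. wa x mod p \<noteq> v#}"
  have SFE: "S = F + E" unfolding F_def E_def by (rule multiset_partition)
  have FS: "F \<subseteq># S" by (simp add: F_def)
  have wF: "wa x mod p = v" "x \<in># S" if "x \<in># F" for x using that by (auto simp: F_def)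
  have szFE: "size F + size E = p * q + p + q - 2" using S SFE by (metis size_union)
  have szE: "size E \<le> p + 2 * q - 4" using conc by (simp add: E_def)
  define f where "f = (\<lambda>x. int (wa x) - int v)"
  obtain E' where E': "E' \<subseteq># E" "int p dvd (\<Sum>x\<in>#E'. f x)" "size E - (p - 1) \<le> size E'"
    using zero_sum_submultiset_of_size_about[OF m_pos order_refl, of E f] by blast
  \<comment> \<open>\<open>M\<close> terms of \<open>F\<close> complete \<open>E'\<close> to length
    \<open>p * q\<close>; then \<open>F\<close> has at least \<open>q - 1\<close> terms to spare, as
    needed to choose from \<open>q - 1\<close> pairs.\<close>
  define M where "M = p * q - size E'"
  have szE': "size E' \<le> size E" using E'(1) by (rule size_mset_mono)
  have M: "size E' + M = p * q" "q - 1 \<le> M" "p + q - 3 \<le> M" "M + (q - 1) \<le> size F"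
    using szE' szE szFE pq p3 q7 E'(3) unfolding M_def by linarith+
  have bal: "p dvd asum (E'' + F'')"
    if "int p dvd (\<Sum>x\<in>#E''. f x)" "F'' \<subseteq># F" "size E'' + size F'' = p * q" for E'' F''
    using that wF by (intro asum_balanced[where v = v]) (auto simp: f_def dest: mset_subset_eqD)
  have sub: "E'' + F'' \<subseteq># S" if "E'' \<subseteq># E" "F'' \<subseteq># F" for E'' F''
    unfolding SFE using that by (metis add.commute subset_mset.add_mono)
  have "F \<noteq> {#}" using M(4) q7 p3 by auto
  then have fin: "finite (count F ` set_mset F)" "count F ` set_mset F \<noteq> {}" by auto
  obtain g where g: "g \<in># F" "count F g = Max (count F ` set_mset F)" using Max_in[OF fin] by (metis imageE)
  have gmax: "count F x \<le> count F g" for x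
  proof (cases "x \<in># F")
    case True
    then show ?thesis using g fin by (auto intro: Max_ge)
  next
    case False
    then show ?thesis by (simp add: not_in_iff)
  qed
  show ?thesis
  proof (cases "count F g \<le> M")
    case True
    have "q - 1 \<le> size {#z \<in># F. id z \<noteq> x#}" for x
    proof -
      have "size {#z \<in># F. z = x#} + size {#z \<in># F. z \<noteq> x#} = size F" by (rule size_filter_compl)
      moreover have "size {#z \<in># F. z = x#} = count F x" by (simp add: filter_eq_replicate_mset)
      ultimately show ?thesis using gmax[of x] True M(4) by simp
    qed
    moreover have "2 * (q - 1) \<le> size F" using M by simp
    ultimately obtain ps where ps: "length ps = q - 1" "\<forall>(x, y) \<in> set ps. id x \<noteq> id y" "pairs_mset ps \<subseteq># F"
      using disjoint_pairs_distinct_key[of "q - 1" F id] by blast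
    \<comment> \<open>Distinct terms of \<open>F\<close> have the same weight modulo
      \<open>p\<close>, so by \<open>inj\<close> their \<open>y\<close>-exponents differ.\<close>
    have "[wa x = wa y] (mod p) \<and> \<not> [wb x = wb y] (mod int q)" if "(x, y) \<in> set ps" for x y
    proof -
      have "x \<in># pairs_mset ps" "y \<in># pairs_mset ps" using that by (force simp: pairs_mset_def)+
      then have xy: "x \<in># F" "y \<in># F" using ps(3) by (auto dest: mset_subset_eqD)
      have "[wa x = wa y] (mod p)" using wF(1)[OF xy(1)] wF(1)[OF xy(2)] by (simp add: cong_def)
      then show ?thesis using ps(2) that inj wF(2)[OF xy(1)] wF(2)[OF xy(2)] by fastforce
    qed
    then have dist: "\<forall>(x, y) \<in> set ps. [wa x = wa y] (mod p) \<and> \<not> [wb x = wb y] (mod int q)" by blast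
    have "M - (q - 1) \<le> size (F - pairs_mset ps)" using ps M by (simp add: size_Diff_submset)
    then obtain R where R: "R \<subseteq># F - pairs_mset ps" "size R = M - (q - 1)" by (rule submultiset_of_size)
    have "min q (card (tws {E' + R}) + card (tws (selections ps)) - 1) \<le> card (tws ({E' + R} + selections ps))"
    proof (rule card_tws_plus[where c = "asum (mset (map fst ps))"])
      show "[asum N = asum (mset (map fst ps))] (mod p)" if "N \<in> selections ps" for N
        using dist that by (intro selections_asum) auto
    qed auto
    moreover have "min q (length ps + 1) \<le> card (tws (selections ps))" by (rule card_tws_selections[OF dist])
    moreover have "card (tws {E' + R}) \<ge> 1" by (rule card_tws_pos) simp
    ultimately have full: "q \<le> card (tws ({E' + R} + selections ps))" using ps(1) prime_gt_0_nat[OF prime_n] by simp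
    have sel: "\<exists>V. N = E' + V \<and> V \<subseteq># F \<and> size V = M" if N: "N \<in> {E' + R} + selections ps" for N
    proof -
      obtain X V where XV: "N = X + V" "X \<in> {E' + R}" "V \<in> selections ps"
        using N by (rule set_plus_elim)
      then have V: "N = E' + (R + V)" "V \<in> selections ps" by (simp_all add: add.assoc)
      have "R + V \<subseteq># (F - pairs_mset ps) + pairs_mset ps"
        by (intro subset_mset.add_mono R selections_subset V)
      then have "R + V \<subseteq># F" using ps(3) by simp
      then show ?thesis using V R(2) M(2) ps(1) selections_size[OF V(2)] by (intro exI[of _ "R + V"]) auto
    qed
    obtain T where "T \<in> {E' + R} + selections ps" "product_one T"
      by (rule product_one_of_full[OF full]) (use sel bal[OF E'(2)] M(1) in blast)+
    then show ?thesis using sel sub[OF E'(1)] M(1) by (metis size_union)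
  next
    case False
    then have rep: "replicate_mset k g \<subseteq># F" if "k \<le> M" for k
      using that by (simp flip: count_le_replicate_mset_subset_eq)
    have T1: "E' + replicate_mset M g \<subseteq># S" "p dvd asum (E' + replicate_mset M g)"
      "size (E' + replicate_mset M g) = p * q"
      using sub[OF E'(1) rep[OF order_refl]] bal[OF E'(2) rep[OF order_refl]] M(1) by auto
    consider "ident g" | "\<not> ident g" "p dvd wa g" | "\<not> p dvd wa g" by blast
    then show ?thesis
    proof cases
      case 1
      have "replicate_mset (count F g) g \<subseteq># S" using FS by (meson count_le_replicate_mset_subset_eq mset_subset_eq_count)
      then have "filter_mset ident (replicate_mset (count F g) g) \<subseteq># filter_mset ident S" by (rule multiset_filter_mono)
      moreover have "filter_mset ident (replicate_mset (count F g) g) = replicate_mset (count F g) g"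
        using 1 by (auto simp: filter_mset_eq_conv)
      ultimately have "count F g \<le> size (filter_mset ident S)" using size_mset_mono by fastforce
      \<comment> \<open>More than \<open>M\<close> copies of \<open>g\<close>, hence at least
        \<open>p + q - 2\<close> identities.\<close>
      then show ?thesis using False M(3) by (intro product_one_many_idents S) linarith
    next
      case 2
      show ?thesis
      proof (cases "E' = {#}")
        case True
        \<comment> \<open>Here \<open>M = p * q\<close>, and that many copies of \<open>g\<close>
          multiply to \<open>1\<close>.\<close>
        have "int q dvd tw (replicate M g)"
          using tw_replicate_cong[OF 2(2), of M] M(1) True cong_dvd_iff by fastforce
        then have "product_one (replicate_mset M g)" unfolding product_one_def
          using T1(2) True by (auto intro!: exI[of _ "replicate M g"])
        then show ?thesis using T1 True by auto
      next
        case False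
        \<comment> \<open>The coset of \<open>g\<close> is \<open>N\<close> itself, so
          \<open>u\<close> lies outside \<open>N\<close>; moving it past \<open>q - 1\<close> copies
          of \<open>g\<close> reaches all \<open>q\<close> exponents.\<close>
        then obtain u where u: "u \<in># E'" by auto
        then have "u \<in># E" using E'(1) by (auto dest: mset_subset_eqD)
        then have "\<not> p dvd wa u" using 2(2) wF(1)[OF g(1)] by (auto simp: E_def dvd_eq_mod_eq_0)
        then have "\<not> comm u g" using comm_kernel_iff[OF 2(2,1)] by simp
        then have "q - 1 + 1 \<le> card (tws {add_mset u (replicate_mset (q - 1) g)})"
          using 2(2) q7 by (intro card_tws_moving) auto
        moreover have "{#u#} + replicate_mset (q - 1) g \<subseteq># E' + replicate_mset M g"
          using u M(2) by (intro subset_mset.add_mono) (auto simp: mset_subset_eq_single subseteq_mset_def)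
        ultimately have "product_one (E' + replicate_mset M g)"
          using T1(2) by (intro product_one_of_full_submset[of "add_mset u (replicate_mset (q - 1) g)"]) auto
        then show ?thesis using T1 by blast
      qed
    next
      case 3
      show ?thesis
      proof (cases "size {#x \<in># S. \<not> comm x g#} < q")
        case True
        then show ?thesis by (rule product_one_small_noncentralizer[OF S 3])
      next
        case False
        obtain r where r: "q - 1 \<le> (p - 1) * r" "2 * r + p \<le> q + 2" by (rule movers_bound)
        have full: "q \<le> card (tws {U + replicate_mset (q - 1) g})"
          if "U \<subseteq># {#x \<in># X. \<not> comm x g#}" "size U = r" for U X
        proof -
          have "\<forall>u \<in># U. \<not> comm u g" using that(1) by (auto dest: mset_subset_eqD)
          then show ?thesis using card_tws_moving_many[of U g "q - 1"] 3 r(1) that(2) q7 by simp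
        qed
        show ?thesis
        proof (cases "r \<le> size {#x \<in># E'. \<not> comm x g#}")
          case True
          then obtain U where U: "U \<subseteq># {#x \<in># E'. \<not> comm x g#}" "size U = r" by (rule submultiset_of_size)
          have "U \<subseteq># E'" using U(1) multiset_filter_subset subset_mset.order_trans by blast
          then have "U + replicate_mset (q - 1) g \<subseteq># E' + replicate_mset M g"
            using M(2) by (intro subset_mset.add_mono) (auto simp: subseteq_mset_def)
          then have "product_one (E' + replicate_mset M g)"
            using T1(2) full[OF U] by (intro product_one_of_full_submset)
          then show ?thesis using T1 by blast
        next
          case few: False
          have "S = F + (E' + (E - E'))" using SFE E'(1) by simp
          then have "size {#x \<in># S. \<not> comm x g#} = size {#x \<in># F. \<not> comm x g#}
              + (size {#x \<in># E'. \<not> comm x g#} + size {#x \<in># E - E'. \<not> comm x g#})"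
            by (metis filter_union_mset size_union)
          moreover have "size {#x \<in># E - E'. \<not> comm x g#} \<le> p - 1"
            using size_filter_mset_lesseq[of "\<lambda>x. \<not> comm x g" "E - E'"] E'(1,3) by (simp add: size_Diff_submset)
          \<comment> \<open>Of at least \<open>q\<close> terms not commuting with \<open>g\<close>,
            at most \<open>r - 1\<close> lie in \<open>E'\<close> and \<open>p - 1\<close> in
            \<open>E - E'\<close>; the bound \<open>2 * r + p \<le> q + 2\<close> leaves
            \<open>r\<close> in \<open>F\<close>.\<close>
          ultimately have "r \<le> size {#x \<in># F. \<not> comm x g#}" using few False r(2) p3 by linarith
          then obtain U where U: "U \<subseteq># {#x \<in># F. \<not> comm x g#}" "size U = r" by (rule submultiset_of_size)
          \<comment> \<open>As \<open>g\<close> commutes with itself, \<open>U\<close> contains no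
            copy of \<open>g\<close>, so \<open>U\<close> and the copies of \<open>g\<close> fit
            into \<open>F\<close> together.\<close>
          have "count U g = 0" using U(1) by (metis (mono_tags, lifting) comm_refl count_filter_mset le_zero_eq mset_subset_eq_count)
          moreover have "U \<subseteq># F" using U(1) multiset_filter_subset subset_mset.order_trans by blast
          ultimately have UF: "U + replicate_mset (q - 1) g \<subseteq># F"
            using rep[OF M(2)] by (auto simp: subseteq_mset_def) (metis add_0)
          \<comment> \<open>At least \<open>t\<close> terms have to come from \<open>E\<close>, none
            if \<open>F\<close> is long enough. Taking hardly more leaves room in the part from
            \<open>F\<close> for \<open>U\<close> and the \<open>q - 1\<close> copies of
            \<open>g\<close>.\<close>
          define t where "t = p * q - size F"
          have "t \<le> size E - (p - 1)" 
          proof -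
            have "p * q + (p - 1) \<le> size F + size E" unfolding szFE using q7 p3 by simp
            then show ?thesis unfolding t_def by linarith
          qed
          then obtain E'' where E'': "E'' \<subseteq># E" "int p dvd (\<Sum>x\<in>#E''. f x)" "t \<le> size E''" "size E'' \<le> t + p - 1"
            using zero_sum_submultiset_of_size_about[OF m_pos, of t E f] by blast
          have le: "size E'' \<le> p * q" "p * q - size E'' \<le> size F" "r + (q - 1) \<le> p * q - size E''"
            using E''(3,4) szFE szE pq r(2) p3 q7 unfolding t_def by linarith+
          then obtain F'' where F'': "U + replicate_mset (q - 1) g \<subseteq># F''" "F'' \<subseteq># F" "size F'' = p * q - size E''"
            using submultiset_between[OF UF, of "p * q - size E''"] U(2) by auto
          have sz: "size E'' + size F'' = p * q" using F''(3) le(1) by simp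
          have "U + replicate_mset (q - 1) g \<subseteq># E'' + F''" using F''(1) by (simp add: subset_mset.add_increasing)
          then have "product_one (E'' + F'')"
            using full[OF U] bal[OF E''(2) F''(2) sz] by (intro product_one_of_full_submset)
          then show ?thesis using sub[OF E''(1) F''(2)] sz by (metis size_union)
        qed
      qed
    qed
  qed
qed

section \<open>Product-one subsequences whose length is a multiple of \<open>p * q\<close>\<close>

lemma product_one_length_pq:
  assumes S: "size S \<ge> p * q + p + q - 2"
    and inj: "\<And>x y. x \<in># S \<Longrightarrow> y \<in># S \<Longrightarrow> [wa x = wa y] (mod p) \<Longrightarrow> [wb x = wb y] (mod int q) \<Longrightarrow> x = y"
  shows "\<exists>T. T \<subseteq># S \<and> size T = p * q \<and> product_one T"
proof -
  obtain S' where S': "S' \<subseteq># S" "size S' = p * q + p + q - 2" using S by (rule submultiset_of_size)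
  have inj': "x = y" if "x \<in># S'" "y \<in># S'" "[wa x = wa y] (mod p)" "[wb x = wb y] (mod int q)" for x y
    using inj that S'(1) by (meson mset_subset_eqD)
  have "\<exists>T. T \<subseteq># S' \<and> size T = p * q \<and> product_one T"
  proof (cases "\<exists>v. size {#x \<in># S'. wa x mod p \<noteq> v#} \<le> p + 2 * q - 4")
    case True
    then show ?thesis using product_one_concentrated[OF S'(2) inj'] by blast
  next
    case False
    have "p + 2 * q - 3 \<le> size {#x \<in># S'. wa x mod p \<noteq> v#}" for v
    proof -
      have "p + 2 * q - 4 < size {#x \<in># S'. wa x mod p \<noteq> v#}" using False by (meson not_less)
      then show ?thesis by linarith
    qed
    then show ?thesis by (rule product_one_spread[OF S'(2)])
  qed
  then show ?thesis using S'(1) by (meson subset_mset.order_trans)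
qed

lemma product_one_length_multiple:
  assumes "size S \<ge> j * (p * q) + p + q - 2"
    and inj: "\<And>x y. x \<in># S \<Longrightarrow> y \<in># S \<Longrightarrow> [wa x = wa y] (mod p) \<Longrightarrow> [wb x = wb y] (mod int q) \<Longrightarrow> x = y"
  shows "\<exists>T. T \<subseteq># S \<and> size T = j * (p * q) \<and> product_one T"
  using assms(1)
proof (induction j)
  case (Suc j)
  have "j * (p * q) + p + q - 2 \<le> size S" using Suc.prems unfolding mult_Suc by linarith
  then obtain T where T: "T \<subseteq># S" "size T = j * (p * q)" "product_one T" using Suc.IH by blast
  have "size (S - T) \<ge> p * q + p + q - 2" using Suc.prems T p_ge_3 by (simp add: size_Diff_submset)
  then obtain V where V: "V \<subseteq># S - T" "size V = p * q" "product_one V"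
    using product_one_length_pq[of "S - T"] inj by (meson in_diffD)
  have "T + V \<subseteq># S" using V(1) T(1) by (metis add.commute subset_mset.le_diff_conv2)
  then show ?case using T V product_one_plus by (intro exI[of _ "T + V"]) auto
qed auto

section \<open>Blocks of length \<open>k * p\<close> with product in \<open>N\<close>\<close>

text \<open>Erdos-Ginzburg-Ziv splits off one block at a time. Blocks are lists, so that each has a
  definite product.\<close>

lemma disjoint_zero_blocks:
  assumes "k > 0" "size S \<ge> j * (k * p) + p - 1"
  shows "\<exists>xss. length xss = j \<and> (\<forall>xs \<in> set xss. length xs = k * p \<and> p dvd asum (mset xs)) \<and> mset (concat xss) \<subseteq># S"
  using assms(2)
proof (induction j)
  case 0
  then show ?case by (intro exI[of _ "[]"]) auto
next
  case (Suc j)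
  have "j * (k * p) + p - 1 \<le> size S" using Suc.prems unfolding mult_Suc by linarith
  then obtain xss where xss: "length xss = j" "\<forall>xs \<in> set xss. length xs = k * p \<and> p dvd asum (mset xs)"
    "mset (concat xss) \<subseteq># S" using Suc.IH by blast
  have "length (concat xss) = j * (k * p)"
    using xss(1,2) by (induction xss arbitrary: j) auto
  then have "k * p + p - 1 \<le> size (S - mset (concat xss))"
    using Suc.prems xss(3) m_pos by (simp add: size_Diff_submset)
  then obtain V where V: "V \<subseteq># S - mset (concat xss)" "size V = k * p" "int p dvd (\<Sum>x\<in>#V. int (wa x))"
    using Erdos_Ginzburg_Ziv[OF prime_p, of "k * p" "S - mset (concat xss)" "\<lambda>x. int (wa x)"] assms(1) m_pos by auto
  obtain xs where xs: "mset xs = V" using ex_mset by blast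
  have "p dvd asum (mset xs)" using V(3) xs int_asum by (metis int_dvd_int_iff)
  moreover have "mset (concat (xs # xss)) \<subseteq># S"
    using V(1) xs xss(3) by (simp add: subset_mset.le_diff_conv2)
  ultimately show ?case using xss V(2) xs by (intro exI[of _ "xs # xss"]) auto
qed

text \<open>Elements of \<open>N\<close> multiply by adding exponents, so among \<open>q\<close>
  blocks some nonempty collection has exponents summing to zero modulo \<open>q\<close>.\<close>

lemma product_one_from_zero_blocks:
  assumes k: "k > 0" and S: "size S \<ge> k * p * q + p - 1"
  shows "\<exists>T. T \<subseteq># S \<and> T \<noteq> {#} \<and> k * p dvd size T \<and> product_one T"
proof -
  have "size S \<ge> q * (k * p) + p - 1" using S by (simp add: mult_ac)
  then obtain xss where xss: "length xss = q" "\<forall>xs \<in> set xss. length xs = k * p \<and> p dvd asum (mset xs)"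
    "mset (concat xss) \<subseteq># S" using disjoint_zero_blocks[OF k] by blast
  have "q > 0" using prime_n prime_gt_0_nat by blast
  from zero_sum_submultiset[OF this, of "mset xss" tw] xss(1)
  obtain V where V: "V \<subseteq># mset xss" "V \<noteq> {#}" "int q dvd (\<Sum>xs\<in>#V. tw xs)" by auto
  obtain yss where yss: "mset yss = V" using ex_mset by blast
  have "yss \<noteq> []" using yss V(2) by auto
  have blk: "\<forall>xs \<in> set yss. length xs = k * p \<and> p dvd asum (mset xs)"
    using V(1) yss xss(2) by (metis mset_subset_eqD set_mset_mset)
  have "[tw (concat zss) = (\<Sum>xs\<leftarrow>zss. tw xs)] (mod int q) \<and> p dvd asum (mset (concat zss))
      \<and> length (concat zss) = length zss * (k * p)"
    if "\<forall>xs \<in> set zss. length xs = k * p \<and> p dvd asum (mset xs)" for zss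
    using that
  proof (induction zss)
    case (Cons zs zss)
    then have "[s ^ asum (mset (concat zss)) = 1] (mod int q)" by (auto simp: s_pow_eq_1_iff)
    then have "[s ^ asum (mset (concat zss)) * tw zs + tw (concat zss) = 1 * tw zs + (\<Sum>xs\<leftarrow>zss. tw xs)] (mod int q)"
      using Cons by (intro cong_add cong_mult cong_refl) auto
    then show ?case using Cons by (auto simp: tw_append)
  qed auto
  from this[OF blk] have y: "[tw (concat yss) = (\<Sum>xs\<leftarrow>yss. tw xs)] (mod int q)" "p dvd asum (mset (concat yss))"
    "length (concat yss) = length yss * (k * p)" by auto
  have "int q dvd tw (concat yss)" using y(1) V(3) yss cong_dvd_iff by (metis mset_map sum_mset_sum_list)
  then have "product_one (mset (concat yss))" using y(2) by (auto simp: product_one_def)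
  moreover have "mset (concat yss) \<subseteq># S"
  proof -
    have "mset (concat zss) = (\<Sum>xs\<in>#mset zss. mset xs)" for zss :: "'a list list" by (induction zss) auto
    then have "mset (concat yss) \<subseteq># mset (concat xss)"
      using V(1) yss by (metis (no_types, lifting) image_mset_union mset_subset_eq_add_left subset_mset.add_diff_inverse sum_mset.union)
    then show ?thesis using xss(3) by (rule subset_mset.order_trans)
  qed
  moreover have "size (mset (concat yss)) = length yss * (k * p)" using y(3) by simp
  ultimately show ?thesis using \<open>yss \<noteq> []\<close> k m_pos by (intro exI[of _ "mset (concat yss)"]) fastforce
qed

end

section \<open>The presented group\<close>

lemma pres_class_eq_iff: "pres_class R u = pres_class R v \<longleftrightarrow> pres_eq R u v"
  unfolding pres_class_def using pres_eq.refl pres_eq.sym pres_eq.trans by blast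

text \<open>As \<open>pres_eq\<close> is a congruence, the union in the definition is over copies of
  one class.\<close>

lemma presented_group_mult:
  "pres_class R u \<otimes>\<^bsub>presented_group R\<^esub> pres_class R v = pres_class R (u @ v)"
proof -
  have "pres_class R (u' @ v') = pres_class R (u @ v)" if "pres_eq R u u'" "pres_eq R v v'" for u' v'
    using that pres_class_eq_iff pres_eq.append pres_eq.sym by metis
  moreover have mem: "x \<in> pres_class R w \<longleftrightarrow> pres_eq R w x" for x w by (simp add: pres_class_def)
  ultimately have "(\<Union>u'\<in>pres_class R u. \<Union>v'\<in>pres_class R v. pres_class R (u' @ v'))
      = (\<Union>u'\<in>pres_class R u. \<Union>v'\<in>pres_class R v. pres_class R (u @ v))"
    by (intro SUP_cong) simp_all
  moreover have "u \<in> pres_class R u" "v \<in> pres_class R v" by (simp_all add: pres_class_def pres_eq.refl)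
  then have "pres_class R u \<noteq> {}" "pres_class R v \<noteq> {}" by blast+
  ultimately show ?thesis by (simp add: presented_group_def)
qed

text \<open>The formal inverse of \<open>x\<close> gets weight \<open>p - 1\<close>, so that all powers of \<open>s\<close> have natural exponents.\<close>

fun letter_a :: "nat \<Rightarrow> gen \<times> bool \<Rightarrow> nat" where
  "letter_a p (gen_x, b) = (if b then p - 1 else 1)"
| "letter_a p (gen_y, b) = 0"

fun letter_b :: "gen \<times> bool \<Rightarrow> int" where
  "letter_b (gen_x, b) = 0"
| "letter_b (gen_y, b) = (if b then - 1 else 1)"

locale pq_presentation =
  fixes p q :: nat and s :: int
  assumes prime_p: "prime p" and prime_q: "prime q" and p_ge_3: "p \<ge> 3" and p_dvd: "p dvd q - 1"
    and s_pow: "[s ^ p = 1] (mod int q)"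
    and order_s: "\<And>d. 0 < d \<Longrightarrow> d < p \<Longrightarrow> \<not> [s ^ d = 1] (mod int q)"
begin

text \<open>On words, \<open>W.asum\<close> and \<open>W.tw\<close> compute the exponents of
  \<open>x\<close> modulo \<open>p\<close> and of \<open>y\<close> modulo \<open>q\<close>.\<close>

sublocale W: twisted q p s "letter_a p" letter_b
  by unfold_locales (use prime_q s_pow p_ge_3 in auto)

definition rels :: "(gen word \<times> gen word) set" where
  "rels = {(word_pow gen_x (int p), []), (word_pow gen_y (int q), []),
    (word_pow gen_y 1 @ word_pow gen_x 1, word_pow gen_x 1 @ word_pow gen_y s)}"

abbreviation eqv (infix "\<sim>" 50) where "u \<sim> v \<equiv> pres_eq rels u v"

abbreviation wordA :: "gen word \<Rightarrow> nat" where "wordA w \<equiv> W.asum (mset w)"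

abbreviation X :: "nat \<Rightarrow> gen word" where "X a \<equiv> replicate a (gen_x, False)"
abbreviation Y :: "nat \<Rightarrow> gen word" where "Y b \<equiv> replicate b (gen_y, False)"

lemma Gpq_eq: "Gpq p q s = presented_group rels"
  by (simp add: Gpq_def rels_def)

lemma wordA_replicate [simp]: "W.asum (replicate_mset k l) = k * letter_a p l"
  by (induction k) auto

lemma tw_X [simp]: "W.tw (replicate k (gen_x, b)) = 0"
  by (induction k) auto

lemma tw_Y [simp]: "W.tw (replicate k (gen_y, b)) = int k * letter_b (gen_y, b)"
  by (induction k) (auto simp: algebra_simps)

text \<open>Both exponents respect every rule generating \<open>pres_eq\<close>, so they are well
  defined on the group and keep it from collapsing.\<close>

lemma eqv_invariant:
  assumes "u \<sim> v" shows "[wordA u = wordA v] (mod p) \<and> [W.tw u = W.tw v] (mod int q)"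
  using assms
proof (induction rule: pres_eq.induct)
  case (rel u v)
  then show ?case using p_ge_3
    by (auto simp: rels_def word_pow_def W.tw_append cong_def)
next
  case (cancel g b)
  then show ?case using p_ge_3 by (cases g; cases b) (auto simp: cong_def)
next
  case (append u v u' v')
  then have "[s ^ wordA u' * W.tw u + W.tw u' = s ^ wordA v' * W.tw v + W.tw v'] (mod int q)"
    by (intro cong_add cong_mult W.s_pow_cong) auto
  then show ?case using append by (auto simp: W.tw_append intro!: cong_add)
qed (auto intro: cong_sym cong_trans)

section \<open>Normal forms of words\<close>

lemma eqv_sandwich: "u \<sim> v \<Longrightarrow> w @ u @ w' \<sim> w @ v @ w'"
  by (intro pres_eq.append pres_eq.refl)

lemma X_p: "X p \<sim> []" and Y_q: "Y q \<sim> []"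
  using pres_eq.rel[of _ _ rels] by (force simp: rels_def word_pow_def)+

lemma power_trivial:
  assumes "replicate k l \<sim> []" shows "replicate a l \<sim> replicate (a mod k) l"
proof -
  have "replicate (k * c) l \<sim> []" for c
  proof (induction c)
    case (Suc c)
    then show ?case using pres_eq.append[OF assms Suc] by (simp add: replicate_add)
  qed (auto intro: pres_eq.refl)
  from pres_eq.append[OF this[of "a div k"] pres_eq.refl[of _ "replicate (a mod k) l"]]
  show ?thesis by (simp flip: replicate_add)
qed

lemma inverse_letter:
  assumes "replicate k (g, False) \<sim> []" "k > 0"
  shows "[(g, True)] \<sim> replicate (k - 1) (g, False)"
proof -
  obtain j where k: "k = Suc j" using assms(2) gr0_implies_Suc by blast
  have "[(g, True)] @ replicate k (g, False) \<sim> [(g, True)] @ []"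
    by (intro pres_eq.append pres_eq.refl assms(1))
  moreover have "[(g, True), (g, \<not> True)] @ replicate j (g, False) \<sim> [] @ replicate j (g, False)"
    by (intro pres_eq.append pres_eq.refl pres_eq.cancel)
  ultimately show ?thesis using k pres_eq.sym pres_eq.trans by fastforce
qed

lemma letter_normal_form: "\<exists>a b. [l] \<sim> X a @ Y b"
proof -
  have pos: "p > 0" "q > 0" using prime_p prime_q prime_gt_0_nat by auto
  obtain g b where l: "l = (g, b)" by (cases l)
  consider "l = (gen_x, False)" | "l = (gen_y, False)" | "l = (gen_x, True)" | "l = (gen_y, True)"
    using l by (cases g; cases b) auto
  then show ?thesis
  proof cases
    case 1
    then show ?thesis by (intro exI[of _ 1] exI[of _ 0]) (simp add: pres_eq.refl)
  next
    case 2
    then show ?thesis by (intro exI[of _ 0] exI[of _ 1]) (simp add: pres_eq.refl)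
  next
    case 3
    then show ?thesis using inverse_letter[OF X_p pos(1)] by (intro exI[of _ "p - 1"] exI[of _ 0]) simp
  next
    case 4
    then show ?thesis using inverse_letter[OF Y_q pos(2)] by (intro exI[of _ 0] exI[of _ "q - 1"]) simp
  qed
qed

text \<open>For negative \<open>s\<close> the relation contains formal inverses of \<open>y\<close>,
  each equal to \<open>q - 1\<close> letters \<open>y\<close>.\<close>

lemma word_pow_y: "\<exists>c. word_pow gen_y s \<sim> Y c"
proof (cases "s < 0")
  case True
  have "replicate k (gen_y, True) \<sim> Y (k * (q - 1))" for k
  proof (induction k)
    case (Suc k)
    have "[(gen_y, True)] \<sim> Y (q - 1)"
      using inverse_letter[OF Y_q] prime_q prime_gt_0_nat by blast
    from pres_eq.append[OF this Suc] show ?case by (simp flip: replicate_add)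
  qed (auto intro: pres_eq.refl)
  then show ?thesis using True by (auto simp: word_pow_def)
next
  case False
  then show ?thesis by (auto simp: word_pow_def intro: pres_eq.refl)
qed

text \<open>Each \<open>x\<close> moved to the left turns every \<open>y\<close> that it passes into
  \<open>c\<close> of them.\<close>

lemma Y_X: "\<exists>b'. Y b @ X a \<sim> X a @ Y b'"
proof -
  obtain c where c: "word_pow gen_y s \<sim> Y c" using word_pow_y by blast
  have "[(gen_y, False), (gen_x, False)] \<sim> [(gen_x, False)] @ word_pow gen_y s"
    by (rule pres_eq.rel) (simp add: rels_def word_pow_def)
  then have yx: "[(gen_y, False), (gen_x, False)] \<sim> [(gen_x, False)] @ Y c"
    using pres_eq.append[OF pres_eq.refl c] pres_eq.trans by blast
  have Yx: "Y b @ [(gen_x, False)] \<sim> [(gen_x, False)] @ Y (b * c)" for b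
  proof (induction b)
    case (Suc b)
    have "Y (Suc b) @ [(gen_x, False)] \<sim> Y b @ [(gen_x, False)] @ Y c"
      using pres_eq.append[OF pres_eq.refl[of _ "Y b"] yx] by (simp add: replicate_app_Cons_same)
    moreover have "Y b @ [(gen_x, False)] @ Y c \<sim> [(gen_x, False)] @ Y (b * c) @ Y c"
      using pres_eq.append[OF Suc pres_eq.refl[of _ "Y c"]] by simp
    moreover have "Y (b * c) @ Y c = Y (Suc b * c)" by (simp add: add.commute flip: replicate_add)
    ultimately show ?case using pres_eq.trans by simp
  qed (simp add: pres_eq.refl)
  show ?thesis
  proof (induction a arbitrary: b)
    case 0
    then show ?case by (auto intro: pres_eq.refl)
  next
    case (Suc a)
    obtain b' where b': "Y (b * c) @ X a \<sim> X a @ Y b'" using Suc by blast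
    have "Y b @ X (Suc a) \<sim> [(gen_x, False)] @ Y (b * c) @ X a"
      using pres_eq.append[OF Yx[of b] pres_eq.refl[of _ "X a"]] by simp
    moreover have "[(gen_x, False)] @ Y (b * c) @ X a \<sim> X (Suc a) @ Y b'"
      using pres_eq.append[OF pres_eq.refl[of _ "[(gen_x, False)]"] b'] by simp
    ultimately have "Y b @ X (Suc a) \<sim> X (Suc a) @ Y b'" by (rule pres_eq.trans)
    then show ?case by blast
  qed
qed

lemma normal_form: "\<exists>a b. w \<sim> X a @ Y b"
proof (induction w)
  case Nil
  then show ?case by (intro exI[of _ 0]) (simp add: pres_eq.refl)
next
  case (Cons l w)
  obtain a b where w: "w \<sim> X a @ Y b" using Cons by blast
  obtain i j where l: "[l] \<sim> X i @ Y j" using letter_normal_form by blast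
  obtain j' where j': "Y j @ X a \<sim> X a @ Y j'" using Y_X by blast
  have "[l] @ w \<sim> (X i @ Y j) @ (X a @ Y b)" by (intro pres_eq.append l w)
  moreover have "X i @ (Y j @ X a) @ Y b \<sim> X i @ (X a @ Y j') @ Y b" by (rule eqv_sandwich[OF j'])
  moreover have "X i @ (X a @ Y j') @ Y b = X (i + a) @ Y (j' + b)" by (simp add: replicate_add)
  ultimately have "l # w \<sim> X (i + a) @ Y (j' + b)" using pres_eq.trans by fastforce
  then show ?case by blast
qed

text \<open>Every word reduces to a normal form, whose exponents matter only modulo \<open>p\<close>
  and \<open>q\<close> and are read off by the invariants.\<close>

lemma eqv_iff: "u \<sim> v \<longleftrightarrow> [wordA u = wordA v] (mod p) \<and> [W.tw u = W.tw v] (mod int q)"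
proof
  assume inv: "[wordA u = wordA v] (mod p) \<and> [W.tw u = W.tw v] (mod int q)"
  obtain a b where u: "u \<sim> X a @ Y b" using normal_form by blast
  obtain c d where v: "v \<sim> X c @ Y d" using normal_form by blast
  have "[a = c] (mod p)" "[int b = int d] (mod int q)"
    using eqv_invariant[OF u] eqv_invariant[OF v] inv
    by (auto simp: W.tw_append cong_def)
  then have "a mod p = c mod p" "b mod q = d mod q" unfolding cong_int_iff by (simp_all add: cong_def)
  then have "X a \<sim> X c" "Y b \<sim> Y d"
    using power_trivial[OF X_p] power_trivial[OF Y_q] by (metis pres_eq.sym pres_eq.trans)+
  then have "X a @ Y b \<sim> X c @ Y d" by (rule pres_eq.append)
  then show "u \<sim> v" using u v pres_eq.sym pres_eq.trans by metis
qed (rule eqv_invariant)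

section \<open>Group elements as terms, and the upper bound\<close>

definition rep :: "gen word set \<Rightarrow> gen word" where
  "rep g = (SOME w. g = pres_class rels w)"

lemma pres_class_rep: "g \<in> carrier (Gpq p q s) \<Longrightarrow> pres_class rels (rep g) = g"
  unfolding Gpq_eq presented_group_def rep_def by (simp, elim rangeE) (metis (mono_tags) someI)

text \<open>A group element gets the exponents of a chosen word, which are determined modulo
  \<open>p\<close> and \<open>q\<close> only.\<close>

sublocale G: metacyclic q p s "\<lambda>g. wordA (rep g)" "\<lambda>g. W.tw (rep g)"
  by unfold_locales (use prime_p prime_q s_pow p_ge_3 p_dvd order_s in auto)

lemma foldr_mult:
  assumes "set gs \<subseteq> carrier (Gpq p q s)"
  shows "foldr (\<otimes>\<^bsub>Gpq p q s\<^esub>) gs \<one>\<^bsub>Gpq p q s\<^esub> = pres_class rels (concat (map rep gs))"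
  using assms
proof (induction gs)
  case Nil
  then show ?case by (simp add: Gpq_eq presented_group_def)
next
  case (Cons g gs)
  then have "foldr (\<otimes>\<^bsub>Gpq p q s\<^esub>) (g # gs) \<one>\<^bsub>Gpq p q s\<^esub>
      = pres_class rels (rep g) \<otimes>\<^bsub>presented_group rels\<^esub> pres_class rels (concat (map rep gs))"
    using pres_class_rep[of g] by (simp add: Gpq_eq)
  then show ?case by (simp add: presented_group_mult)
qed

lemma wordA_concat: "wordA (concat (map rep gs)) = G.asum (mset gs)"
  by (induction gs) auto

lemma tw_concat: "W.tw (concat (map rep gs)) = G.tw gs"
  by (induction gs) (auto simp: W.tw_append wordA_concat)

lemma one_product_seq_iff:
  assumes "set_mset S \<subseteq> carrier (Gpq p q s)"
  shows "one_product_seq (Gpq p q s) S \<longleftrightarrow> G.product_one S"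
proof -
  have "foldr (\<otimes>\<^bsub>Gpq p q s\<^esub>) gs \<one>\<^bsub>Gpq p q s\<^esub> = \<one>\<^bsub>Gpq p q s\<^esub>
      \<longleftrightarrow> p dvd G.asum S \<and> int q dvd G.tw gs" if "mset gs = S" for gs
  proof -
    have "\<one>\<^bsub>Gpq p q s\<^esub> = pres_class rels []" by (simp add: Gpq_eq presented_group_def)
    moreover have "set gs \<subseteq> carrier (Gpq p q s)" using assms that by auto
    ultimately have "foldr (\<otimes>\<^bsub>Gpq p q s\<^esub>) gs \<one>\<^bsub>Gpq p q s\<^esub> = \<one>\<^bsub>Gpq p q s\<^esub>
        \<longleftrightarrow> concat (map rep gs) \<sim> []"
      using foldr_mult pres_class_eq_iff by metis
    then show ?thesis using that by (simp add: eqv_iff wordA_concat tw_concat cong_0_iff)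
  qed
  then show ?thesis unfolding one_product_seq_def G.product_one_def by blast
qed

text \<open>Supplies the injectivity assumption of
  \<open>product_one_length_multiple\<close>.\<close>

lemma carrier_inj:
  assumes "g \<in> carrier (Gpq p q s)" "h \<in> carrier (Gpq p q s)"
    "[wordA (rep g) = wordA (rep h)] (mod p)" "[W.tw (rep g) = W.tw (rep h)] (mod int q)"
  shows "g = h"
  using assms pres_class_rep pres_class_eq_iff eqv_iff by metis

text \<open>The gcd is \<open>q\<close> or \<open>1\<close>: the former leads to lengths that are
  multiples of \<open>p * q\<close>, the latter to \<open>q\<close> blocks of length
  \<open>k * p\<close>.\<close>

lemma upper_bound:
  assumes k: "k > 0" and S: "set_mset S \<subseteq> carrier (Gpq p q s)"
    "size S \<ge> lcm (k * p) q + p - 2 + gcd (k * p) q"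
  shows "\<exists>T. T \<subseteq># S \<and> T \<noteq> {#} \<and> k * p dvd size T \<and> one_product_seq (Gpq p q s) T"
proof -
  have "\<exists>T. T \<subseteq># S \<and> T \<noteq> {#} \<and> k * p dvd size T \<and> G.product_one T"
  proof (cases "q dvd k * p")
    case True
    then have "q dvd k" using prime_p prime_q G.q_ge 
      by (auto simp: prime_dvd_mult_iff primes_dvd_imp_eq dest: primes_dvd_imp_eq[rotated 2])
    then obtain j where j: "k = q * j" by blast
    have "size S \<ge> j * (p * q) + p + q - 2"
      using True S(2) p_ge_3 j by (simp add: lcm_proj1_if_dvd gcd_proj2_iff mult_ac)
    then obtain T where T: "T \<subseteq># S" "size T = j * (p * q)" "G.product_one T"
      using G.product_one_length_multiple[of j S] S(1) carrier_inj by (meson subset_iff)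
    then have "size T = k * p" using j by (simp add: mult_ac)
    moreover have "k * p > 0" using k p_ge_3 by simp
    ultimately show ?thesis using T by (intro exI[of _ T]) auto
  next
    case False
    then have "coprime (k * p) q" using prime_q by (metis coprime_commute prime_imp_coprime)
    then have "size S \<ge> k * p * q + p - 1"
      using S(2) p_ge_3 by (simp add: lcm_coprime)
    then show ?thesis by (rule G.product_one_from_zero_blocks[OF k])
  qed
  then show ?thesis using one_product_seq_iff S(1) by (meson mset_subset_eqD subset_iff)
qed

section \<open>Sequences attaining the lower bound\<close>

definition gx :: "gen word set" where "gx = pres_class rels [(gen_x, False)]"
definition gy :: "gen word set" where "gy = pres_class rels [(gen_y, False)]"
definition g1 :: "gen word set" where "g1 = pres_class rels []"

lemma generators_in_carrier: "gx \<in> carrier (Gpq p q s)" "gy \<in> carrier (Gpq p q s)" "g1 \<in> carrier (Gpq p q s)"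
  by (auto simp: gx_def gy_def g1_def Gpq_eq presented_group_def)

lemma rep_pres_class: "rep (pres_class rels w) \<sim> w"
proof -
  have "pres_class rels w \<in> carrier (Gpq p q s)" by (simp add: Gpq_eq presented_group_def)
  then have "pres_class rels (rep (pres_class rels w)) = pres_class rels w" by (rule pres_class_rep)
  then show ?thesis by (simp only: pres_class_eq_iff)
qed

lemma weights:
  "[wordA (rep gx) = 1] (mod p)" "[wordA (rep gy) = 0] (mod p)" "[wordA (rep g1) = 0] (mod p)"
  "[W.tw (rep gy) = 1] (mod int q)" "[W.tw (rep g1) = 0] (mod int q)"
  using eqv_invariant[OF rep_pres_class[of "[(gen_x, False)]"]]
    eqv_invariant[OF rep_pres_class[of "[(gen_y, False)]"]] eqv_invariant[OF rep_pres_class[of "[]"]]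
  by (simp_all add: gx_def gy_def g1_def)

text \<open>Fewer than \<open>p\<close> copies of \<open>x\<close> have weight divisible by
  \<open>p\<close> only if there are none. The other terms lie in \<open>N\<close>, where exponents
  add, so the number of \<open>y\<close> is a multiple of \<open>q\<close>.\<close>

lemma product_one_generators:
  assumes one: "G.product_one (replicate_mset i g1 + replicate_mset j gy + replicate_mset l gx)" and l: "l < p"
  shows "l = 0" "q dvd j"
proof -
  let ?T = "replicate_mset i g1 + replicate_mset j gy + replicate_mset l gx"
  have "[G.asum ?T = i * 0 + j * 0 + l * 1] (mod p)"
    unfolding G.asum_simps G.asum_replicate by (intro cong_add cong_mult cong_refl weights)
  then have "p dvd l" using one by (metis G.product_one_def add_0 cong_dvd_iff mult.right_neutral mult_0_right)
  then show l0: "l = 0" using l by (metis dvd_imp_le not_less gr0I)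
  obtain xs where xs: "mset xs = replicate_mset i g1 + replicate_mset j gy" "int q dvd G.tw xs"
    using one l0 by (auto simp: G.product_one_def)
  have "[G.tw ys = (\<Sum>g\<in>#mset ys. W.tw (rep g))] (mod int q) \<and> p dvd G.asum (mset ys)"
    if "set ys \<subseteq> {g1, gy}" for ys
    using that
  proof (induction ys)
    case (Cons y ys)
    then have IH: "[G.tw ys = (\<Sum>g\<in>#mset ys. W.tw (rep g))] (mod int q)" "p dvd G.asum (mset ys)" by auto
    have "p dvd wordA (rep y)" using Cons.prems weights by (auto simp: cong_0_iff)
    moreover have "[s ^ G.asum (mset ys) * W.tw (rep y) + G.tw ys = 1 * W.tw (rep y) + (\<Sum>g\<in>#mset ys. W.tw (rep g))] (mod int q)"
      using IH by (intro cong_add cong_mult cong_refl) (auto simp: G.s_pow_eq_1_iff)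
    ultimately show ?case using IH by simp
  qed auto
  moreover have "set xs \<subseteq> {g1, gy}"
  proof -
    have "set_mset (mset xs) \<subseteq> {g1, gy}" unfolding xs(1) by (auto split: if_splits)
    then show ?thesis by simp
  qed
  ultimately have "[G.tw xs = (\<Sum>g\<in>#mset xs. W.tw (rep g))] (mod int q)" by blast
  also have "(\<Sum>g\<in>#mset xs. W.tw (rep g)) = int i * W.tw (rep g1) + int j * W.tw (rep gy)"
    unfolding xs(1) by simp
  also have "[\<dots> = int i * 0 + int j * 1] (mod int q)" by (intro cong_add cong_mult cong_refl weights)
  finally have "[G.tw xs = int j] (mod int q)" by simp
  then have "int q dvd int j" using xs(2) cong_dvd_iff by blast
  then show "q dvd j" by simp
qed

lemma submultiset_generators:
  assumes "T \<subseteq># replicate_mset a g1 + replicate_mset b gy + replicate_mset c gx"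
  obtains i j l where "T = replicate_mset i g1 + replicate_mset j gy + replicate_mset l gx" "i \<le> a" "j \<le> b" "l \<le> c"
proof -
  have split: "\<exists>T1 T2. T = T1 + T2 \<and> T1 \<subseteq># A \<and> T2 \<subseteq># B" if "T \<subseteq># A + B" for T A B :: "gen word set multiset"
    using that by (intro exI[of _ "T \<inter># A"] exI[of _ "T - A"])
      (auto simp: subset_eq_diff_conv add.commute multiset_eq_iff)
  obtain U T3 where U: "T = U + T3" "U \<subseteq># replicate_mset a g1 + replicate_mset b gy" "T3 \<subseteq># replicate_mset c gx"
    using split[OF assms] by blast
  obtain T1 T2 where "U = T1 + T2" "T1 \<subseteq># replicate_mset a g1" "T2 \<subseteq># replicate_mset b gy"
    using split[OF U(2)] by blast
  then show ?thesis using U that by (metis msubseteq_replicate_msetE)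
qed

text \<open>In a product-one part of \<open>S\<close> there is no \<open>x\<close> and the number of
  \<open>y\<close> is a multiple of \<open>q\<close>; a length divisible by \<open>k * p\<close>
  then leaves only the empty part.\<close>

lemma lower_bound:
  assumes k: "k > 0"
  shows "\<exists>S. set_mset S \<subseteq> carrier (Gpq p q s) \<and> size S = lcm (k * p) q + p - 2 + gcd (k * p) q - 1
    \<and> (\<forall>T. T \<subseteq># S \<and> T \<noteq> {#} \<and> k * p dvd size T \<longrightarrow> \<not> one_product_seq (Gpq p q s) T)"
proof -
  have pos: "k * p > 0" "q > 0" using k p_ge_3 prime_q prime_gt_0_nat by auto
  \<comment> \<open>If \<open>q\<close> divides \<open>k * p\<close>, there are too few
    \<open>y\<close> for a multiple of \<open>q\<close> and too few identities for the length.
    Otherwise only \<open>y\<close> is used, one copy short of \<open>k * p * q\<close>.\<close>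
  define a b where "a = (if q dvd k * p then k * p - 1 else 0)" and "b = (if q dvd k * p then q - 1 else k * p * q - 1)"
  define S where "S = replicate_mset a g1 + replicate_mset b gy + replicate_mset (p - 1) gx"
  have carrier: "set_mset S \<subseteq> carrier (Gpq p q s)" using generators_in_carrier by (auto simp: S_def split: if_splits)
  moreover have "size S = lcm (k * p) q + p - 2 + gcd (k * p) q - 1"
  proof (cases "q dvd k * p")
    case True
    then have "size S = (k * p - 1) + (q - 1) + (p - 1)" "lcm (k * p) q = k * p" "gcd (k * p) q = q"
      by (auto simp: S_def a_def b_def lcm_proj1_if_dvd gcd_proj2_iff)
    then show ?thesis using pos p_ge_3 by linarith
  next
    case False
    then have "coprime (k * p) q" using prime_q by (metis coprime_commute prime_imp_coprime)
    moreover have "k * p * q > 0" using pos by simp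
    ultimately show ?thesis using False p_ge_3 by (simp add: S_def a_def b_def lcm_coprime)
  qed
  moreover have False if T: "T \<subseteq># S" "T \<noteq> {#}" "k * p dvd size T" "one_product_seq (Gpq p q s) T" for T
  proof -
    have "G.product_one T" using one_product_seq_iff T(1,4) carrier by (meson mset_subset_eqD subset_iff)
    moreover obtain i j l where ijl: "T = replicate_mset i g1 + replicate_mset j gy + replicate_mset l gx"
      "i \<le> a" "j \<le> b" "l \<le> p - 1" using submultiset_generators T(1) unfolding S_def by blast
    ultimately have l: "l = 0" and qj: "q dvd j" using product_one_generators[of i j l] p_ge_3 by auto
    have sz: "k * p dvd i + j" using T(3) ijl(1) l by simp
    show False
    proof (cases "q dvd k * p")
      case True
      have "j = 0" using qj ijl(3) True pos by (auto simp: b_def dest: dvd_imp_le)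
      moreover have "i = 0" using sz \<open>j = 0\<close> ijl(2) True pos by (auto simp: a_def dest: dvd_imp_le)
      ultimately show False using T(2) ijl(1) l by simp
    next
      case False
      then have "coprime (k * p) q" using prime_q by (metis coprime_commute prime_imp_coprime)
      moreover have i: "i = 0" using ijl(2) False by (simp add: a_def)
      ultimately have "k * p * q dvd j" using sz qj by (simp add: divides_mult)
      then have "j = 0" using ijl(3) False pos by (auto simp: b_def dest: dvd_imp_le)
      then show False using T(2) ijl(1) l i by simp
    qed
  qed
  ultimately show ?thesis by blast
qed

end

theorem theorem1p5:
  fixes p q k :: nat and s :: int
  assumes "prime p" and "prime q" and "p \<ge> 3" and "p dvd q - 1"
    and "[s ^ p = 1] (mod int q)"
    and "\<And>d. 0 < d \<Longrightarrow> d < p \<Longrightarrow> \<not> [s ^ d = 1] (mod int q)"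
    and "k > 0"
  shows "s_dN (k * p) (Gpq p q s) = enat (lcm (k * p) q + p - 2 + gcd (k * p) q)"
proof -
  interpret pq_presentation p q s by unfold_locales (use assms in auto)
  let ?L = "lcm (k * p) q + p - 2 + gcd (k * p) q"
  let ?P = "\<lambda>l. \<forall>S. set_mset S \<subseteq> carrier (Gpq p q s) \<and> size S \<ge> l \<longrightarrow>
       (\<exists>T. T \<subseteq># S \<and> T \<noteq> {#} \<and> k * p dvd size T \<and> one_product_seq (Gpq p q s) T)"
  have "?P ?L" using upper_bound[OF assms(7)] by blast
  moreover have "?L \<le> l" if "?P l" for l
  proof (rule ccontr)
    assume "\<not> ?L \<le> l"
    then have "l \<le> ?L - 1" by simp
    then show False using lower_bound[OF assms(7)] that by metis
  qed
  ultimately have "Inf {enat l | l. ?P l} = enat ?L"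
    by (intro cInf_eq_minimum) auto
  then show ?thesis by (simp only: s_dN_def)
qed

end
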